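(* Let $T\colon E\longrightarrow F$ be a weakly compact operator between Banach lattices and suppose that one of the following holds: (a) $T$ is regular and $F$ has the positive Schur property. (b) $T$ is positive, $F$ has order continuous norm and $E^{*}$ has the positive Schur property. Then $T^{*} \colon F^* \longrightarrow E^*$ is almost limited, hence $T^{**} \colon E^{**} \longrightarrow F^{**}$ is almost Dunford-Pettis.
   Context: Operators are linear. An operator between Banach lattices is regular if it is the difference of two positive operators. A Banach lattice has the positive Schur property if every weakly null sequence of positive elements in it is norm null. An operator $S$ from a Banach space $Y$ to a Banach lattice $G$ is almost limited if $S^*$ sends disjoint weak$^*$-null sequences in $G^*$ to norm null sequences in $Y^*$. An operator from a Banach lattice to a Banach space is almost Dunford-Pettis if it sends disjoint weakly null sequences to norm null sequences (equivalently, positive disjoint weakly null sequences to norm null sequences). *)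

theory Defs
  imports "HOL-Analysis.Analysis" "HOL-Library.Lattice_Algebras"
begin

section \<open>Banach lattices\<close>

class banach_lattice = banach + ordered_real_vector + lattice_ab_group_add_abs +
  assumes norm_mono: "\<bar>x\<bar> \<le> \<bar>y\<bar> \<Longrightarrow> norm x \<le> norm y"

instance real :: banach_lattice
  by standard simp

lemma norm_abs_lattice [simp]: "norm \<bar>x::'a::banach_lattice\<bar> = norm x"
  by (intro order.antisym norm_mono) simp_all

lemma norm_mono_pos:
  fixes x y :: "'a::banach_lattice"
  assumes "0 \<le> x" "x \<le> y"
  shows "norm x \<le> norm y"
  using assms by (intro norm_mono) (simp add: abs_of_nonneg order_trans[OF assms])

section \<open>The dual of a Banach lattice\<close>

text \<open>
  The dual of \<open>E\<close> is the type \<open>E \<Rightarrow>\<^sub>L real\<close> with its operator norm. To make it an instance of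
  \<^class>\<open>banach_lattice\<close>, an arity for \<open>blinfun\<close> is needed whose second argument is
  a class; this class has, up to isometric lattice isomorphism, the type \<^typ>\<open>real\<close> as its only
  instance.
\<close>

class real_scalar = banach_lattice + real_normed_algebra_1 +
  assumes scalar_multiple_of_one: "\<exists>r. x = r *\<^sub>R 1"
    and zero_le_one_scalar: "0 \<le> 1"

instance real :: real_scalar
  by standard auto

definition coord :: "'b::real_scalar \<Rightarrow> real" where
  "coord x = (THE r. of_real r = x)"

lemma coord_of_real [simp]: "coord (of_real r) = r"
  unfolding coord_def by (rule the_equality) auto

lemma of_real_coord [simp]: "of_real (coord x) = x"
  using scalar_multiple_of_one[of x] unfolding of_real_def[symmetric] by auto

lemma coord_eq_iff: "coord x = coord y \<longleftrightarrow> x = y"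
  by (metis of_real_coord)

lemma coord_real [simp]: "coord (x::real) = x"
  using of_real_coord[of x] by simp

lemma coord_add: "coord (x + y) = coord x + coord y"
  by (metis of_real_coord coord_of_real of_real_add)

lemma coord_scaleR: "coord (r *\<^sub>R x) = r * coord x"
  by (metis of_real_coord coord_of_real of_real_mult scaleR_conv_of_real)

lemma coord_norm: "\<bar>coord x\<bar> = norm x"
  by (metis of_real_coord norm_of_real)

lemma bounded_linear_coord: "bounded_linear coord"
  by (rule bounded_linear_intro[where K = 1])
     (simp_all add: coord_add coord_scaleR coord_norm)

lemma coord_uminus: "coord (- x) = - coord x"
  by (metis of_real_coord coord_of_real of_real_minus)

lemma coord_diff: "coord (x - y) = coord x - coord y"
  by (metis of_real_coord coord_of_real of_real_diff)

lemma of_real_nonneg: "0 \<le> r \<Longrightarrow> 0 \<le> (of_real r :: 'b::real_scalar)"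
  unfolding of_real_def by (rule scaleR_nonneg_nonneg[OF _ zero_le_one_scalar])

lemma coord_nonneg_iff: "0 \<le> coord x \<longleftrightarrow> 0 \<le> x"
proof
  assume "0 \<le> coord x"
  from of_real_nonneg[OF this] show "0 \<le> x" by (metis of_real_coord)
next
  assume x: "0 \<le> x"
  show "0 \<le> coord x"
  proof (rule ccontr)
    assume "\<not> 0 \<le> coord x"
    hence neg: "0 < coord (- x)" by (simp add: coord_uminus)
    from of_real_nonneg[OF less_imp_le[OF this]] have "0 \<le> - x" by (metis of_real_coord)
    with x have "x = 0" by simp
    with neg show False by (metis coord_of_real of_real_0 less_irrefl minus_zero)
  qed
qed

lemma coord_le_iff: "coord x \<le> coord y \<longleftrightarrow> x \<le> y"
  using coord_nonneg_iff[of "y - x"] by (simp add: coord_diff)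

lemma riesz_decomposition:
  fixes u x y :: "'a::lattice_ab_group_add"
  assumes "0 \<le> u" "u \<le> x + y" "0 \<le> x" "0 \<le> y"
  obtains v w where "0 \<le> v" "v \<le> x" "0 \<le> w" "w \<le> y" "u = v + w"
proof
  show "0 \<le> inf u x" "inf u x \<le> x" using assms by auto
  have "u - inf u x = sup 0 (u - x)"
    by (simp add: diff_inf_eq_sup add_sup_distrib_left)
  moreover have "u - x \<le> y" using assms by (simp add: diff_le_eq add.commute)
  ultimately show "0 \<le> u - inf u x" "u - inf u x \<le> y" using assms by auto
  show "u = inf u x + (u - inf u x)" by (simp only: add_diff_eq add_diff_cancel_left')
qed

lemma riesz_kantorovich:
  fixes f :: "'a::banach_lattice \<Rightarrow> real"
  assumes f: "bounded_linear f"
  shows "\<exists>h. bounded_linear h \<and> (\<forall>x\<ge>0. h x = Sup (f ` {0..x}))"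
proof -
  interpret f: bounded_linear f by fact
  obtain K where K: "K > 0" "\<And>x. norm (f x) \<le> norm x * K" using f.pos_bounded by auto
  define p where "p x = Sup (f ` {0..x})" for x
  have bd: "f y \<le> norm x * K" if "0 \<le> y" "y \<le> x" for x y
  proof -
    have "f y \<le> norm y * K" using K(2)[of y] by simp
    also have "\<dots> \<le> norm x * K" using norm_mono_pos[OF that] K(1) by simp
    finally show ?thesis .
  qed
  have bdd: "bdd_above (f ` {0..x})" for x
    using bd by (intro bdd_aboveI2[where M = "norm x * K"]) auto
  have p_ge: "f y \<le> p x" if "0 \<le> y" "y \<le> x" for x y
    unfolding p_def using bdd that by (intro cSup_upper) auto
  have p_le: "p x \<le> c" if "0 \<le> x" "\<And>y. 0 \<le> y \<Longrightarrow> y \<le> x \<Longrightarrow> f y \<le> c" for x c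
    unfolding p_def using that by (intro cSup_least) auto
  have p_nonneg: "0 \<le> p x" if "0 \<le> x" for x
    using p_ge[of 0 x] that by (simp add: f.zero)
  have p_bd: "p x \<le> norm x * K" if "0 \<le> x" for x
    using that bd by (intro p_le) auto
  have p_add: "p (x + y) = p x + p y" if "0 \<le> x" "0 \<le> y" for x y
  proof (rule order.antisym)
    show "p (x + y) \<le> p x + p y"
    proof (rule p_le)
      show "0 \<le> x + y" using that by simp
      fix u assume "0 \<le> u" "u \<le> x + y"
      then obtain v w where "0 \<le> v" "v \<le> x" "0 \<le> w" "w \<le> y" "u = v + w"
        using riesz_decomposition \<open>0 \<le> x\<close> \<open>0 \<le> y\<close> by blast
      thus "f u \<le> p x + p y"
        using p_ge[of v x] p_ge[of w y] by (simp add: f.add)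
    qed
    have "f v + f w \<le> p (x + y)" if "0 \<le> v" "v \<le> x" "0 \<le> w" "w \<le> y" for v w
      using p_ge[of "v + w" "x + y"] that by (simp add: f.add add_mono)
    hence "f v \<le> p (x + y) - f w" if "0 \<le> v" "v \<le> x" "0 \<le> w" "w \<le> y" for v w
      using that by (simp add: le_diff_eq)
    hence "p x \<le> p (x + y) - f w" if "0 \<le> w" "w \<le> y" for w
      using \<open>0 \<le> x\<close> that by (intro p_le) auto
    hence "f w \<le> p (x + y) - p x" if "0 \<le> w" "w \<le> y" for w
      using that by (simp add: algebra_simps)
    hence "p y \<le> p (x + y) - p x"
      using \<open>0 \<le> y\<close> by (intro p_le) auto
    thus "p x + p y \<le> p (x + y)" by simp
  qed
  have p_scale_le: "p (r *\<^sub>R x) \<le> r * p x" if "0 < r" "0 \<le> x" for r x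
  proof (rule p_le)
    show "0 \<le> r *\<^sub>R x" using that by (simp add: scaleR_nonneg_nonneg)
    fix y assume y: "0 \<le> y" "y \<le> r *\<^sub>R x"
    have "inverse r *\<^sub>R y \<le> inverse r *\<^sub>R (r *\<^sub>R x)"
      using y that by (intro scaleR_left_mono) auto
    hence "f (inverse r *\<^sub>R y) \<le> p x"
      using that y by (intro p_ge) (auto simp: scaleR_nonneg_nonneg)
    thus "f y \<le> r * p x" using that by (simp add: f.scaleR field_simps)
  qed
  have p_scale: "p (r *\<^sub>R x) = r * p x" if "0 \<le> r" "0 \<le> x" for r x
  proof (cases "r = 0")
    case True
    have "p 0 = 0" using p_add[of 0 0] by simp
    thus ?thesis using True by simp
  next
    case False
    with that have r: "0 < r" by simp
    have "p (inverse r *\<^sub>R (r *\<^sub>R x)) \<le> inverse r * p (r *\<^sub>R x)"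
      using r that by (intro p_scale_le) (auto simp: scaleR_nonneg_nonneg)
    hence "r * p x \<le> p (r *\<^sub>R x)" using r by (simp add: field_simps)
    with p_scale_le[OF r that(2)] show ?thesis by simp
  qed
  define h where "h x = p (pprt x) - p (- nprt x)" for x
  have h_eq: "h x = p a - p b" if "x = a - b" "0 \<le> a" "0 \<le> b" for x a b
  proof -
    have "pprt x + nprt x = a - b" using prts[of x] that(1) by simp
    hence "pprt x + b = a + - nprt x" by (simp add: algebra_simps)
    hence "p (pprt x + b) = p (a + - nprt x)" by (rule arg_cong)
    hence "p (pprt x) + p b = p a + p (- nprt x)"
      using that by (subst (asm) p_add, simp, simp, subst (asm) p_add, simp, simp) simp
    thus ?thesis by (simp add: h_def)
  qed
  have dec: "x = pprt x - (- nprt x)" for x :: 'a using prts[of x] by simp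
  have "bounded_linear h"
  proof (rule bounded_linear_intro[where K = "2 * K"])
    fix x y :: 'a
    have "x + y = (pprt x + pprt y) - (- nprt x + - nprt y)"
      by (subst (1) prts[of x], subst (1) prts[of y]) (simp only: diff_conv_add_uminus minus_add_distrib minus_minus ac_simps)
    hence "h (x + y) = p (pprt x + pprt y) - p (- nprt x + - nprt y)"
      by (rule h_eq) ((rule add_nonneg_nonneg; simp)+)
    also have "\<dots> = p (pprt x) + p (pprt y) - (p (- nprt x) + p (- nprt y))"
      by (subst p_add, simp, simp, subst p_add) simp_all
    also have "\<dots> = h x + h y" by (simp add: h_def)
    finally show "h (x + y) = h x + h y" .
  next
    fix r x
    show "h (r *\<^sub>R x) = r *\<^sub>R h x"
    proof (cases "0 \<le> r")
      case True
      have "r *\<^sub>R x = r *\<^sub>R pprt x - r *\<^sub>R (- nprt x)"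
        using dec[of x] by (metis scaleR_diff_right)
      hence "h (r *\<^sub>R x) = p (r *\<^sub>R pprt x) - p (r *\<^sub>R (- nprt x))"
        using True by (intro h_eq) (auto intro!: scaleR_nonneg_nonneg simp del: scaleR_minus_right)
      also have "\<dots> = r * p (pprt x) - r * p (- nprt x)"
        using True by (simp add: p_scale del: scaleR_minus_right)
      finally show ?thesis by (simp add: h_def algebra_simps)
    next
      case False
      have "r *\<^sub>R x = (- r) *\<^sub>R (- nprt x) - (- r) *\<^sub>R pprt x"
        by (subst dec[of x]) (simp add: algebra_simps)
      hence "h (r *\<^sub>R x) = p ((- r) *\<^sub>R (- nprt x)) - p ((- r) *\<^sub>R pprt x)"
        using False by (intro h_eq)
          (auto intro!: scaleR_nonneg_nonneg simp del: scaleR_minus_right scaleR_minus_left)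
      also have "\<dots> = (- r) * p (- nprt x) - (- r) * p (pprt x)"
        using False by (simp add: p_scale del: scaleR_minus_right scaleR_minus_left)
      finally show ?thesis by (simp add: h_def algebra_simps)
    qed
  next
    fix x :: 'a
    have a: "norm (pprt x) \<le> norm x"
      by (rule norm_mono) (simp add: abs_prts)
    have b: "norm (- nprt x) \<le> norm x"
      by (rule norm_mono) (simp add: abs_prts)
    have "\<bar>h x\<bar> \<le> p (pprt x) + p (- nprt x)"
      using p_nonneg[of "pprt x"] p_nonneg[of "- nprt x"] by (simp add: h_def)
    also have "\<dots> \<le> norm (pprt x) * K + norm (- nprt x) * K"
      by (intro add_mono p_bd) auto
    also have "\<dots> \<le> norm x * K + norm x * K"
      using a b K(1) by (intro add_mono mult_right_mono) auto
    also have "\<dots> = norm x * (2 * K)" by (simp add: algebra_simps)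
    finally show "norm (h x) \<le> norm x * (2 * K)" by (simp only: real_norm_def)
  qed
  moreover have "h x = p x" if "0 \<le> x" for x
    using h_eq[of x x 0] that p_add[of 0 0] by simp
  ultimately show ?thesis unfolding p_def by blast
qed

instantiation blinfun :: (banach_lattice, real_scalar) ordered_real_vector
begin

definition less_eq_blinfun :: "'a \<Rightarrow>\<^sub>L 'b \<Rightarrow> 'a \<Rightarrow>\<^sub>L 'b \<Rightarrow> bool" where
  "f \<le> g \<longleftrightarrow> (\<forall>x\<ge>0. blinfun_apply f x \<le> blinfun_apply g x)"

definition less_blinfun :: "'a \<Rightarrow>\<^sub>L 'b \<Rightarrow> 'a \<Rightarrow>\<^sub>L 'b \<Rightarrow> bool" where
  "f < g \<longleftrightarrow> f \<le> g \<and> \<not> g \<le> (f :: 'a \<Rightarrow>\<^sub>L 'b)"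

instance
proof
  fix f g h :: "'a \<Rightarrow>\<^sub>L 'b" and a b :: real
  show "f < g \<longleftrightarrow> f \<le> g \<and> \<not> g \<le> f" by (rule less_blinfun_def)
  show "f \<le> f" by (simp add: less_eq_blinfun_def)
  show "f \<le> h" if "f \<le> g" "g \<le> h" using that by (auto simp: less_eq_blinfun_def intro: order_trans)
  show "f = g" if "f \<le> g" "g \<le> f"
  proof (rule blinfun_eqI)
    have eq: "blinfun_apply f x = blinfun_apply g x" if "0 \<le> x" for x
      using that \<open>f \<le> g\<close> \<open>g \<le> f\<close> by (auto simp: less_eq_blinfun_def intro: order.antisym)
    fix x :: 'a
    have "x = pprt x - (- nprt x)" using prts[of x] by simp
    moreover have "blinfun_apply f (pprt x - (- nprt x)) = blinfun_apply g (pprt x - (- nprt x))"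
      unfolding blinfun.diff_right by (simp only: eq zero_le_pprt neg_0_le_iff_le nprt_le_zero)
    ultimately show "blinfun_apply f x = blinfun_apply g x" by simp
  qed
  show "h + f \<le> h + g" if "f \<le> g" using that by (auto simp: less_eq_blinfun_def blinfun.add_left)
  show "a *\<^sub>R f \<le> a *\<^sub>R g" if "f \<le> g" "0 \<le> a"
    using that by (auto simp: less_eq_blinfun_def blinfun.scaleR_left intro: scaleR_left_mono)
  show "a *\<^sub>R f \<le> b *\<^sub>R f" if "a \<le> b" "0 \<le> f"
    using that by (auto simp: less_eq_blinfun_def blinfun.scaleR_left intro: scaleR_right_mono)
qed

end

lemma pos_part_blinfun:
  fixes f :: "'a::banach_lattice \<Rightarrow>\<^sub>L 'b::real_scalar"
  obtains p where "f \<le> p" "0 \<le> p" "\<And>h. f \<le> h \<Longrightarrow> 0 \<le> h \<Longrightarrow> p \<le> h"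
    "\<And>x. 0 \<le> x \<Longrightarrow> coord (blinfun_apply p x) = Sup ((\<lambda>y. coord (blinfun_apply f y)) ` {0..x})"
proof -
  have bl: "bounded_linear (\<lambda>y. coord (blinfun_apply f y))"
    by (rule bounded_linear_compose[OF bounded_linear_coord blinfun.bounded_linear_right])
  from riesz_kantorovich[OF this] obtain h where h: "bounded_linear h"
    "\<And>x. 0 \<le> x \<Longrightarrow> h x = Sup ((\<lambda>y. coord (blinfun_apply f y)) ` {0..x})" by auto
  define p where "p = Blinfun (\<lambda>x. of_real (h x) :: 'b)"
  have p: "blinfun_apply p x = of_real (h x)" for x
    unfolding p_def
    by (subst bounded_linear_Blinfun_apply)
       (auto intro: bounded_linear_compose[OF bounded_linear_of_real h(1)])
  have cp: "coord (blinfun_apply p x) = Sup ((\<lambda>y. coord (blinfun_apply f y)) ` {0..x})"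
    if "0 \<le> x" for x using h(2)[OF that] by (simp add: p)
  have bdd: "bdd_above ((\<lambda>y. coord (blinfun_apply f y)) ` {0..x})" for x
  proof (rule bdd_aboveI2)
    fix y assume "y \<in> {0..x}"
    hence "norm y \<le> norm x" by (auto intro: norm_mono_pos)
    have "coord (blinfun_apply f y) \<le> norm (blinfun_apply f y)"
      using coord_norm[of "blinfun_apply f y"] by simp
    also have "\<dots> \<le> norm f * norm y" by (rule norm_blinfun)
    also have "\<dots> \<le> norm f * norm x" using \<open>norm y \<le> norm x\<close> by (intro mult_left_mono) auto
    finally show "coord (blinfun_apply f y) \<le> norm f * norm x" .
  qed
  have ge: "coord (blinfun_apply f y) \<le> coord (blinfun_apply p x)" if "0 \<le> y" "y \<le> x" for x y
  proof -
    have "0 \<le> x" using that by (rule order_trans)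
    show ?thesis unfolding cp[OF \<open>0 \<le> x\<close>] using bdd that by (intro cSup_upper) auto
  qed
  show thesis
  proof
    show "f \<le> p" using ge by (auto simp: less_eq_blinfun_def coord_le_iff)
    show "0 \<le> p" unfolding less_eq_blinfun_def
    proof (intro allI impI)
      fix x :: 'a assume "0 \<le> x"
      from ge[OF order_refl this] show "blinfun_apply 0 x \<le> blinfun_apply p x"
        by (simp add: coord_le_iff)
    qed
    show "p \<le> k" if k: "f \<le> k" "0 \<le> k" for k
      unfolding less_eq_blinfun_def
    proof (intro allI impI)
      fix x :: 'a assume x: "0 \<le> x"
      have "Sup ((\<lambda>y. coord (blinfun_apply f y)) ` {0..x}) \<le> coord (blinfun_apply k x)"
      proof (rule cSup_least)
        fix c assume "c \<in> (\<lambda>y. coord (blinfun_apply f y)) ` {0..x}"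
        then obtain y where y: "0 \<le> y" "y \<le> x" "c = coord (blinfun_apply f y)" by auto
        have "blinfun_apply f y \<le> blinfun_apply k y" using k y by (simp add: less_eq_blinfun_def)
        also have "\<dots> \<le> blinfun_apply k x"
        proof -
          have "0 \<le> blinfun_apply k (x - y)" using k y by (simp add: less_eq_blinfun_def)
          thus ?thesis by (simp add: blinfun.diff_right)
        qed
        finally show "c \<le> coord (blinfun_apply k x)" using y by (simp add: coord_le_iff)
      qed (use x in auto)
      hence "coord (blinfun_apply p x) \<le> coord (blinfun_apply k x)" by (simp only: cp[OF x])
      thus "blinfun_apply p x \<le> blinfun_apply k x" by (simp only: coord_le_iff)
    qed
  qed (rule cp)
qed

lemma sup_blinfun_exists:
  fixes f g :: "'a::banach_lattice \<Rightarrow>\<^sub>L 'b::real_scalar"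
  obtains s where "f \<le> s" "g \<le> s" "\<And>h. f \<le> h \<Longrightarrow> g \<le> h \<Longrightarrow> s \<le> h"
    "\<And>x. 0 \<le> x \<Longrightarrow> coord (blinfun_apply s x) =
       coord (blinfun_apply f x) + Sup ((\<lambda>y. coord (blinfun_apply (g - f) y)) ` {0..x})"
proof -
  obtain p where p: "g - f \<le> p" "0 \<le> p" "\<And>h. g - f \<le> h \<Longrightarrow> 0 \<le> h \<Longrightarrow> p \<le> h"
    "\<And>x. 0 \<le> x \<Longrightarrow> coord (blinfun_apply p x) = Sup ((\<lambda>y. coord (blinfun_apply (g - f) y)) ` {0..x})"
    using pos_part_blinfun[of "g - f"] by blast
  show thesis
  proof
    show "f \<le> f + p" using p(2) by simp
    show "g \<le> f + p" using p(1) by (simp add: algebra_simps)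
    show "f + p \<le> h" if "f \<le> h" "g \<le> h" for h
      using p(3)[of "h - f"] that by (simp add: algebra_simps)
  qed (simp add: blinfun.add_left coord_add p(4))
qed

instantiation blinfun :: (banach_lattice, real_scalar) banach_lattice
begin

definition sup_blinfun :: "'a \<Rightarrow>\<^sub>L 'b \<Rightarrow> 'a \<Rightarrow>\<^sub>L 'b \<Rightarrow> 'a \<Rightarrow>\<^sub>L 'b" where
  "sup f g = (LEAST h. f \<le> h \<and> g \<le> h)" for f g :: "'a \<Rightarrow>\<^sub>L 'b"

definition inf_blinfun :: "'a \<Rightarrow>\<^sub>L 'b \<Rightarrow> 'a \<Rightarrow>\<^sub>L 'b \<Rightarrow> 'a \<Rightarrow>\<^sub>L 'b" where
  "inf f g = (GREATEST h. h \<le> f \<and> h \<le> g)" for f g :: "'a \<Rightarrow>\<^sub>L 'b"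

definition abs_blinfun :: "'a \<Rightarrow>\<^sub>L 'b \<Rightarrow> 'a \<Rightarrow>\<^sub>L 'b" where
  "\<bar>f\<bar> = sup f (- f)" for f :: "'a \<Rightarrow>\<^sub>L 'b"

instance
proof
  fix f g h :: "'a \<Rightarrow>\<^sub>L 'b"
  have sup_props: "f \<le> sup f g \<and> g \<le> sup f g \<and> (\<forall>h. f \<le> h \<longrightarrow> g \<le> h \<longrightarrow> sup f g \<le> h) \<and>
    (\<forall>x\<ge>0. coord (blinfun_apply (sup f g) x) =
       coord (blinfun_apply f x) + Sup ((\<lambda>y. coord (blinfun_apply (g - f) y)) ` {0..x}))"
    for f g :: "'a \<Rightarrow>\<^sub>L 'b"
  proof -
    obtain s where s: "f \<le> s" "g \<le> s" "\<And>h. f \<le> h \<Longrightarrow> g \<le> h \<Longrightarrow> s \<le> h"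
      "\<And>x. 0 \<le> x \<Longrightarrow> coord (blinfun_apply s x) =
         coord (blinfun_apply f x) + Sup ((\<lambda>y. coord (blinfun_apply (g - f) y)) ` {0..x})"
      using sup_blinfun_exists[of f g] by blast
    have "sup f g = s"
      unfolding sup_blinfun_def using s(1-3) by (intro Least_equality) auto
    with s show ?thesis by simp
  qed
  have inf_props: "inf f g \<le> f \<and> inf f g \<le> g \<and> (\<forall>h. h \<le> f \<longrightarrow> h \<le> g \<longrightarrow> h \<le> inf f g)"
    for f g :: "'a \<Rightarrow>\<^sub>L 'b"
  proof -
    have "inf f g = - sup (- f) (- g)"
      unfolding inf_blinfun_def
    proof (rule Greatest_equality)
      show "- sup (- f) (- g) \<le> f \<and> - sup (- f) (- g) \<le> g"
        using sup_props[of "- f" "- g"] by (simp add: minus_le_iff)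
      fix h assume "h \<le> f \<and> h \<le> g"
      thus "h \<le> - sup (- f) (- g)"
        using sup_props[of "- f" "- g"] by (metis le_minus_iff neg_le_iff_le)
    qed
    thus ?thesis using sup_props[of "- f" "- g"]
      by (metis le_minus_iff minus_le_iff neg_le_iff_le)
  qed
  show "f \<le> sup f g" "g \<le> sup f g" using sup_props by auto
  show "sup g h \<le> f" if "g \<le> f" "h \<le> f" using sup_props that by auto
  show "inf f g \<le> f" "inf f g \<le> g" using inf_props by auto
  show "f \<le> inf g h" if "f \<le> g" "f \<le> h" using inf_props that by auto
  show "\<bar>f\<bar> = sup f (- f)" by (rule abs_blinfun_def)
  have abs_pos: "0 \<le> \<bar>g\<bar>" for g :: "'a \<Rightarrow>\<^sub>L 'b"
  proof -
    have "g + (- g) \<le> \<bar>g\<bar> + \<bar>g\<bar>"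
      using sup_props[of g "- g"] unfolding abs_blinfun_def by (intro add_mono) auto
    hence "0 \<le> 2 *\<^sub>R \<bar>g\<bar>" by (simp add: scaleR_2)
    hence "(1/2) *\<^sub>R 0 \<le> (1/2) *\<^sub>R (2 *\<^sub>R \<bar>g\<bar>)" by (intro scaleR_left_mono) auto
    thus ?thesis by simp
  qed
  have abs_norm: "coord (blinfun_apply \<bar>g\<bar> x) \<le> norm g * norm x" if x: "0 \<le> x"
    for g :: "'a \<Rightarrow>\<^sub>L 'b" and x
  proof -
    have "Sup ((\<lambda>y. coord (blinfun_apply (- g - g) y)) ` {0..x})
        \<le> norm g * norm x - coord (blinfun_apply g x)"
    proof (rule cSup_least)
      fix c assume "c \<in> (\<lambda>y. coord (blinfun_apply (- g - g) y)) ` {0..x}"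
      then obtain y where y: "0 \<le> y" "y \<le> x" "c = coord (blinfun_apply (- g - g) y)" by auto
      have "\<bar>x - (y + y)\<bar> \<le> x"
      proof (rule abs_leI)
        have "0 \<le> y + y" using y by (intro add_nonneg_nonneg)
        thus "x - (y + y) \<le> x" by (simp only: diff_le_eq le_add_same_cancel1)
        have "y + y \<le> x + x" using y by (intro add_mono)
        thus "- (x - (y + y)) \<le> x" by (simp add: algebra_simps)
      qed
      hence nle: "norm (x - (y + y)) \<le> norm x"
        using x by (intro norm_mono) (simp add: abs_of_nonneg)
      have "c + coord (blinfun_apply g x) = coord (blinfun_apply g (x - (y + y)))"
        using y(3) by (simp add: blinfun.bilinear_simps coord_add coord_diff coord_uminus)
      also have "\<dots> \<le> norm (blinfun_apply g (x - (y + y)))"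
        using coord_norm[of "blinfun_apply g (x - (y + y))"] by simp
      also have "\<dots> \<le> norm g * norm (x - (y + y))" by (rule norm_blinfun)
      also have "\<dots> \<le> norm g * norm x" using nle by (intro mult_left_mono) auto
      finally show "c \<le> norm g * norm x - coord (blinfun_apply g x)" by simp
    qed (use x in auto)
    thus ?thesis using sup_props[of g "- g"] x unfolding abs_blinfun_def by auto
  qed
  show "norm f \<le> norm g" if le: "\<bar>f\<bar> \<le> \<bar>g\<bar>"
  proof (rule norm_blinfun_bound)
    fix x
    have "norm (blinfun_apply f x) = \<bar>coord (blinfun_apply f x)\<bar>" by (simp add: coord_norm)
    also have "\<dots> \<le> coord (blinfun_apply \<bar>f\<bar> \<bar>x\<bar>)"
    proof -
      have m: "coord (blinfun_apply k y) \<le> coord (blinfun_apply \<bar>f\<bar> y)"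
        if "k \<in> {f, - f}" "0 \<le> y" for k y
      proof -
        have "k \<le> \<bar>f\<bar>"
          using that(1) sup_props[of f "- f"] unfolding abs_blinfun_def by blast
        with that(2) show ?thesis by (simp add: less_eq_blinfun_def coord_le_iff)
      qed
      have px: "0 \<le> pprt x" "0 \<le> - nprt x" by simp_all
      have fx: "coord (blinfun_apply f x)
          = coord (blinfun_apply f (pprt x)) - coord (blinfun_apply f (- nprt x))"
        by (subst prts[of x]) (simp add: blinfun.bilinear_simps coord_add coord_uminus)
      have ax: "coord (blinfun_apply \<bar>f\<bar> \<bar>x\<bar>)
          = coord (blinfun_apply \<bar>f\<bar> (pprt x)) + coord (blinfun_apply \<bar>f\<bar> (- nprt x))"
        by (simp add: abs_prts blinfun.bilinear_simps coord_diff coord_uminus)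
      show ?thesis
        using m[of f, OF _ px(1)] m[of "- f", OF _ px(1)] m[of f, OF _ px(2)] m[of "- f", OF _ px(2)]
        unfolding fx ax by (simp add: blinfun.minus_left coord_uminus)
    qed
    also have "\<dots> \<le> coord (blinfun_apply \<bar>g\<bar> \<bar>x\<bar>)"
      using le by (simp add: less_eq_blinfun_def coord_le_iff)
    also have "\<dots> \<le> norm g * norm \<bar>x\<bar>" by (rule abs_norm) simp
    finally show "norm (blinfun_apply f x) \<le> norm g * norm x" by simp
  qed simp
qed

end

section \<open>Weak and weak-star topologies\<close>

text \<open>The coarsest topology for which all bounded functionals are continuous.\<close>

definition weak_topology :: "'a::real_normed_vector topology" where
  "weak_topology =
     pullback_topology UNIV (\<lambda>x (f :: 'a \<Rightarrow>\<^sub>L real). blinfun_apply f x) euclidean"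

text \<open>For scalar-valued operators the strong operator topology is the topology of pointwise
  convergence on the predual.\<close>

abbreviation weak_star_topology :: "('a::real_normed_vector \<Rightarrow>\<^sub>L real) topology" where
  "weak_star_topology \<equiv> strong_operator_topology"

definition weakly_null :: "(nat \<Rightarrow> 'a::real_normed_vector) \<Rightarrow> bool" where
  "weakly_null x \<longleftrightarrow> limitin weak_topology x 0 sequentially"

definition weak_star_null :: "(nat \<Rightarrow> 'a::real_normed_vector \<Rightarrow>\<^sub>L real) \<Rightarrow> bool" where
  "weak_star_null f \<longleftrightarrow> limitin weak_star_topology f 0 sequentially"

lemma limitin_pullback_UNIV:
  "limitin (pullback_topology UNIV g T) x l F \<longleftrightarrow> limitin T (\<lambda>n. g (x n)) (g l) F"
  by (auto simp: limitin_def topspace_pullback_topology openin_pullback_topology)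

lemma tendsto_fun_iff:
  fixes f :: "'c \<Rightarrow> 'i \<Rightarrow> 'b::topological_space"
  shows "(f \<longlongrightarrow> l) F \<longleftrightarrow> (\<forall>i. ((\<lambda>n. f n i) \<longlongrightarrow> l i) F)"
  unfolding limitin_canonical_iff[symmetric] euclidean_product_topology[symmetric]
  by (simp add: limitin_componentwise)

lemma weakly_null_iff:
  "weakly_null x \<longleftrightarrow> (\<forall>f :: 'a::real_normed_vector \<Rightarrow>\<^sub>L real. (\<lambda>n. blinfun_apply f (x n)) \<longlonglongrightarrow> 0)"
  by (simp add: weakly_null_def weak_topology_def limitin_pullback_UNIV tendsto_fun_iff)

lemma weak_star_null_iff:
  "weak_star_null f \<longleftrightarrow> (\<forall>x. (\<lambda>n. blinfun_apply (f n) x) \<longlonglongrightarrow> 0)"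
  by (simp add: weak_star_null_def strong_operator_topology_def limitin_pullback_UNIV tendsto_fun_iff)

section \<open>Classes of spaces and operators\<close>

definition positive_Schur_property :: "'a::banach_lattice itself \<Rightarrow> bool" where
  "positive_Schur_property _ \<longleftrightarrow>
     (\<forall>x :: nat \<Rightarrow> 'a. (\<forall>n. 0 \<le> x n) \<longrightarrow> weakly_null x \<longrightarrow> x \<longlonglongrightarrow> 0)"

text \<open>Every net decreasing to 0 is norm null. A net decreasing to 0 has a downward directed range
  with infimum 0, so nets may be taken to be such sets \<open>D\<close> indexed by themselves.\<close>

definition order_continuous_norm :: "'a::banach_lattice itself \<Rightarrow> bool" where
  "order_continuous_norm _ \<longleftrightarrow>
     (\<forall>D :: 'a set. D \<noteq> {} \<longrightarrow>
        (\<forall>x\<in>D. \<forall>y\<in>D. \<exists>z\<in>D. z \<le> x \<and> z \<le> y) \<longrightarrow>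
        (\<forall>x\<in>D. 0 \<le> x) \<longrightarrow> (\<forall>b. (\<forall>x\<in>D. b \<le> x) \<longrightarrow> b \<le> 0) \<longrightarrow>
        (\<forall>e>0. \<exists>x\<in>D. \<forall>y\<in>D. y \<le> x \<longrightarrow> norm y < e))"

definition disjoint_seq :: "(nat \<Rightarrow> 'a::banach_lattice) \<Rightarrow> bool" where
  "disjoint_seq x \<longleftrightarrow> (\<forall>m n. m \<noteq> n \<longrightarrow> inf \<bar>x m\<bar> \<bar>x n\<bar> = 0)"

text \<open>Positive linear maps between Banach lattices are automatically bounded, so boundedness is
  not part of the next two definitions.\<close>

definition positive_op :: "('a::banach_lattice \<Rightarrow> 'b::banach_lattice) \<Rightarrow> bool" where
  "positive_op T \<longleftrightarrow> linear T \<and> (\<forall>x\<ge>0. 0 \<le> T x)"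

definition regular_op :: "('a::banach_lattice \<Rightarrow> 'b::banach_lattice) \<Rightarrow> bool" where
  "regular_op T \<longleftrightarrow> (\<exists>A B. positive_op A \<and> positive_op B \<and> T = (\<lambda>x. A x - B x))"

definition weakly_compact_op :: "('a::banach \<Rightarrow>\<^sub>L 'b::banach) \<Rightarrow> bool" where
  "weakly_compact_op T \<longleftrightarrow>
     compactin weak_topology (weak_topology closure_of (blinfun_apply T ` cball 0 1))"

lift_definition dual_op ::
  "('a::real_normed_vector \<Rightarrow>\<^sub>L 'b::real_normed_vector) \<Rightarrow> ('b \<Rightarrow>\<^sub>L real) \<Rightarrow>\<^sub>L ('a \<Rightarrow>\<^sub>L real)"
  is "\<lambda>T f. f o\<^sub>L T"
  by (rule bounded_bilinear.bounded_linear_left[OF bounded_bilinear_blinfun_compose])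

definition almost_limited :: "('y::banach \<Rightarrow>\<^sub>L 'g::banach_lattice) \<Rightarrow> bool" where
  "almost_limited S \<longleftrightarrow>
     (\<forall>g :: nat \<Rightarrow> 'g \<Rightarrow>\<^sub>L real. disjoint_seq g \<longrightarrow> weak_star_null g \<longrightarrow>
        (\<lambda>n. blinfun_apply (dual_op S) (g n)) \<longlonglongrightarrow> 0)"

definition almost_Dunford_Pettis :: "('g::banach_lattice \<Rightarrow>\<^sub>L 'y::banach) \<Rightarrow> bool" where
  "almost_Dunford_Pettis S \<longleftrightarrow>
     (\<forall>x :: nat \<Rightarrow> 'g. disjoint_seq x \<longrightarrow> weakly_null x \<longrightarrow>
        (\<lambda>n. blinfun_apply S (x n)) \<longlonglongrightarrow> 0)"

end

theory Submission
  imports Defs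
begin

text \<open>
  Write \<open>E\<close> and \<open>F\<close> for the domain and the range lattice of \<open>T\<close>, and let \<open>x n\<close> be a disjoint
  weak-star null sequence in \<open>E\<^sup>*\<^sup>*\<close>. Its image under the second adjoint of \<open>T\<close> is to be norm null; this
  is almost limitedness of the adjoint, and since weakly null sequences in \<open>E\<^sup>*\<^sup>*\<close> are weak-star null,
  it contains the almost Dunford-Pettis property of the second adjoint. Three facts carry the proof.

  \<^item> By Gantmacher's theorem (\<open>weakly_compact_bidual\<close>), the second adjoint of a weakly compact operator
    maps \<open>E\<^sup>*\<^sup>*\<close> into \<open>F\<close>.

  \<^item> The moduli \<open>\<bar>x n\<bar>\<close> are weak-star null as well (\<open>abs_weak_star_null\<close>). This rests on disjointness and
    on the Dedekind completeness of \<open>E\<^sup>*\<close>: if the \<open>\<bar>x n\<bar>\<close> stayed away from 0 at some \<open>\<phi> \<ge> 0\<close> in \<open>E\<^sup>*\<close>, then a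
    subsequence would be carried by parts of \<open>\<phi>\<close> whose sum is at most \<open>\<phi>\<close>, and elements of these
    parts on which the \<open>x n\<close> are large would add up to one element of \<open>E\<^sup>*\<close> at which the \<open>x n\<close> do not
    tend to 0.

  \<^item> Hahn-Banach extensions realise moduli and components of functionals (\<open>apply_abs_attained\<close>,
    \<open>component_functional\<close>).

  If \<open>T = A - B\<close> is regular and \<open>F\<close> has the positive Schur property, let \<open>y n\<close> in \<open>F\<close> be the image of
  \<open>x n\<close>. For \<open>f \<ge> 0\<close> in \<open>F\<^sup>*\<close>, the number \<open>f \<bar>y n\<bar>\<close> is at most the value of \<open>\<bar>x n\<bar>\<close> at the functional
  \<open>f \<circ> (A + B)\<close>, which tends to 0. So \<open>\<bar>y n\<bar>\<close> is weakly null and hence norm null.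

  If \<open>T\<close> is positive, \<open>F\<close> has order continuous norm and \<open>E\<^sup>*\<close> has the positive Schur property, assume that
  the images do not tend to 0. Then, for infinitely many \<open>n\<close>, the value of \<open>\<bar>x n\<bar>\<close> at the image \<open>\<phi> n\<close> of
  some positive functional in the dual unit ball of \<open>F\<close> is bounded away from 0. As the moduli are
  weak-star null, the \<open>\<phi> n\<close> can be replaced, along a subsequence, by smaller disjoint elements \<open>w n\<close> of
  \<open>E\<^sup>*\<close> (\<open>disjoint_minorants\<close>). Disjoint positive elements below the images of a bounded sequence under the
  adjoint are weakly null (\<open>disjoint_below_dual_weakly_null\<close>): a positive \<open>G\<close> in \<open>E\<^sup>*\<^sup>*\<close> has components
  carried by the \<open>w n\<close>, whose images form a series in \<open>F\<close> with increasing, weakly convergent partial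
  sums, which converges in norm by order continuity. By the positive Schur property \<open>w n\<close> is norm
  null, a contradiction as the \<open>\<bar>x n\<bar>\<close> are bounded.
\<close>

section \<open>Vector lattices and their duals\<close>

lemma inf_add_le:
  fixes a b c :: "'a::lattice_ab_group_add"
  assumes "0 \<le> a" "0 \<le> b" "0 \<le> c"
  shows "inf a (b + c) \<le> inf a b + inf a c"
proof -
  have "inf a (b + c) \<le> a + inf a c"
    using assms by (intro order_trans[OF inf_le1]) simp
  moreover have "inf a (b + c) \<le> b + inf a c"
    unfolding add_inf_distrib_left
  proof (rule le_infI)
    show "inf a (b + c) \<le> b + a"
      using assms by (intro order_trans[OF inf_le1]) simp
  qed simp
  ultimately show ?thesis
    unfolding add_inf_distrib_right by (rule le_infI)
qed

text \<open>Disjointness from each summand gives disjointness from the sum, since \<open>inf a\<close> is subadditive on the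
positive cone.\<close>

lemma disjoint_sum:
  fixes a :: "'a::lattice_ab_group_add"
  assumes "0 \<le> a" "finite J" "\<And>j. j \<in> J \<Longrightarrow> 0 \<le> b j" "\<And>j. j \<in> J \<Longrightarrow> inf a (b j) = 0"
  shows "inf a (sum b J) = 0"
  using assms(2-4)
proof (induction J rule: finite_induct)
  case empty
  thus ?case using assms(1) by (simp add: inf_absorb2)
next
  case (insert j J)
  have "inf a (b j + sum b J) \<le> inf a (b j) + inf a (sum b J)"
    using insert.prems assms(1) by (intro inf_add_le sum_nonneg) auto
  also have "\<dots> = 0" using insert by simp
  finally have "inf a (b j + sum b J) \<le> 0" .
  moreover have "0 \<le> inf a (b j + sum b J)"
    using insert.prems assms(1) by (intro le_infI add_nonneg_nonneg sum_nonneg) auto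
  ultimately show ?case using insert.hyps by simp
qed

text \<open>A sum of disjoint positive elements is their supremum, because \<open>x + y = sup x y + inf x y\<close>.\<close>

lemma sum_disjoint_le:
  fixes u :: "nat \<Rightarrow> 'a::lattice_ab_group_add"
  assumes "0 \<le> b" "\<And>n. 0 \<le> u n" "\<And>n. u n \<le> b" "\<And>m n. m \<noteq> n \<Longrightarrow> inf (u m) (u n) = 0"
  shows "(\<Sum>n<N. u n) \<le> b"
proof (induction N)
  case 0
  show ?case using assms(1) by simp
next
  case (Suc N)
  have "inf (u N) (\<Sum>n<N. u n) = 0"
    using assms by (intro disjoint_sum) auto
  hence "u N + (\<Sum>n<N. u n) = sup (u N) (\<Sum>n<N. u n)"
    using add_eq_inf_sup[of "u N" "\<Sum>n<N. u n"] by simp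
  also have "\<dots> \<le> b" using Suc assms(3) by simp
  finally show ?case by (simp add: add.commute)
qed

lemma scaleR_sup:
  fixes x y :: "'a::banach_lattice"
  assumes "0 < t"
  shows "sup (t *\<^sub>R x) (t *\<^sub>R y) = t *\<^sub>R sup x y"
proof (rule order.antisym)
  show "sup (t *\<^sub>R x) (t *\<^sub>R y) \<le> t *\<^sub>R sup x y"
    using assms by (intro le_supI scaleR_left_mono) auto
  have "sup x y \<le> inverse t *\<^sub>R sup (t *\<^sub>R x) (t *\<^sub>R y)"
    using assms by (intro le_supI) (simp_all add: pos_le_divideR_eq)
  from scaleR_left_mono[OF this, of t]
  show "t *\<^sub>R sup x y \<le> sup (t *\<^sub>R x) (t *\<^sub>R y)"
    using assms by simp
qed

lemma scaleR_inf:
  fixes x y :: "'a::banach_lattice"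
  assumes "0 < t"
  shows "inf (t *\<^sub>R x) (t *\<^sub>R y) = t *\<^sub>R inf x y"
  unfolding inf_eq_neg_sup using scaleR_sup[OF assms, of "- x" "- y"] by (simp only: scaleR_minus_right)

lemma disjoint_scaleR:
  fixes a b :: "'a::banach_lattice"
  assumes "0 \<le> a" "0 \<le> b" "inf a b = 0" "0 \<le> s" "0 \<le> t"
  shows "inf (s *\<^sub>R a) (t *\<^sub>R b) = 0"
proof (rule order.antisym)
  define m where "m = max 1 (max s t)"
  have "inf (s *\<^sub>R a) (t *\<^sub>R b) \<le> inf (m *\<^sub>R a) (m *\<^sub>R b)"
    using assms by (intro inf_mono scaleR_right_mono) (auto simp: m_def)
  also have "\<dots> = 0" using assms(3) scaleR_inf[of m a b] by (simp add: m_def)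
  finally show "inf (s *\<^sub>R a) (t *\<^sub>R b) \<le> 0" .
  show "0 \<le> inf (s *\<^sub>R a) (t *\<^sub>R b)" using assms by (simp add: scaleR_nonneg_nonneg)
qed

lemma pprt_scaleR: "0 < t \<Longrightarrow> pprt (t *\<^sub>R x) = t *\<^sub>R pprt (x::'a::banach_lattice)"
  using scaleR_sup[of t x 0] by (simp add: pprt_def)

lemma abs_scaleR_pos: "0 < t \<Longrightarrow> \<bar>t *\<^sub>R x\<bar> = t *\<^sub>R \<bar>x::'a::banach_lattice\<bar>"
  using scaleR_sup[of t x "- x"] by (simp add: abs_lattice)

lemma pprt_add_le: "pprt (x + y) \<le> pprt x + pprt (y::'a::lattice_ab_group_add)"
proof -
  have "x + y \<le> pprt x + pprt y"
    by (rule add_mono) (simp_all add: pprt_def)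
  moreover have "0 \<le> pprt x + pprt y" by (rule add_nonneg_nonneg) simp_all
  ultimately show ?thesis unfolding pprt_def[of "x + y"] by (rule le_supI)
qed

lemma pprt_le_abs: "pprt x \<le> \<bar>x::'a::lattice_ab_group_add_abs\<bar>"
  unfolding pprt_def by (rule le_supI) (simp_all add: abs_ge_self)

lemma norm_pprt_le: "norm (pprt x) \<le> norm (x::'a::banach_lattice)"
  using norm_mono_pos[OF zero_le_pprt pprt_le_abs, of x] by simp

lemma pprt_diff_eq_0: "inf (pprt (a - b)) (pprt (b - a)) = (0::'a::lattice_ab_group_add)"
proof -
  have "pprt (a - b) = a + - inf a b" "pprt (b - a) = b + - inf a b"
    by (simp_all add: pprt_def neg_inf_eq_sup add_sup_distrib_left sup_commute)
  hence "inf (pprt (a - b)) (pprt (b - a)) = inf a b + - inf a b"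
    by (simp only: add_inf_distrib_right)
  thus ?thesis by (simp only: right_minus)
qed

text \<open>The positive cone is closed: \<open>pprt (- l)\<close> lies below \<open>\<bar>x n - l\<bar>\<close>, so its norm tends to 0.\<close>

lemma nonneg_limit:
  fixes x :: "nat \<Rightarrow> 'a::banach_lattice"
  assumes "x \<longlonglongrightarrow> l" "\<And>n. 0 \<le> x n"
  shows "0 \<le> l"
proof -
  have "norm (pprt (- l)) \<le> norm (x n - l)" for n
  proof -
    have "- l \<le> x n - l" using assms(2)[of n] by simp
    also have "\<dots> \<le> \<bar>x n - l\<bar>" by (rule abs_ge_self)
    finally have "pprt (- l) \<le> \<bar>x n - l\<bar>" by (simp add: pprt_def)
    from norm_mono_pos[OF _ this] show ?thesis by simp
  qed
  moreover have "(\<lambda>n. norm (x n - l)) \<longlonglongrightarrow> 0"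
    using assms(1) by (simp add: LIM_zero tendsto_norm_zero)
  ultimately have "norm (pprt (- l)) \<le> 0"
    by (intro LIMSEQ_le_const[of _ 0]) auto
  hence "pprt (- l) = 0" by simp
  thus ?thesis by (metis le_zero_iff_zero_pprt neg_le_0_iff_le)
qed

lemma le_suminf_nonneg:
  fixes x :: "nat \<Rightarrow> 'a::banach_lattice"
  assumes "summable x" "\<And>n. 0 \<le> x n"
  shows "x k \<le> suminf x"
proof -
  have "(\<lambda>n. sum x {..<n + Suc k} - x k) \<longlonglongrightarrow> suminf x - x k"
    using summable_LIMSEQ[OF assms(1)]
    by (intro tendsto_diff tendsto_const LIMSEQ_ignore_initial_segment)
  moreover have "0 \<le> sum x {..<n + Suc k} - x k" for n
    using sum_mono2[of "{..<n + Suc k}" "{k}" x] assms(2) by simp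
  ultimately have "0 \<le> suminf x - x k" by (rule nonneg_limit)
  thus ?thesis by simp
qed

lemma blinfun_nonneg:
  fixes F :: "'a::banach_lattice \<Rightarrow>\<^sub>L real"
  shows "0 \<le> F \<Longrightarrow> 0 \<le> x \<Longrightarrow> 0 \<le> F x"
  by (simp add: less_eq_blinfun_def)

lemma blinfun_mono:
  fixes F :: "'a::banach_lattice \<Rightarrow>\<^sub>L real"
  shows "0 \<le> F \<Longrightarrow> x \<le> y \<Longrightarrow> F x \<le> F y"
  using blinfun_nonneg[of F "y - x"] by (simp add: blinfun.diff_right)

lemma blinfun_sup_apply:
  fixes F G :: "'a::banach_lattice \<Rightarrow>\<^sub>L real"
  assumes "0 \<le> x"
  shows "blinfun_apply (sup F G) x = F x + Sup (blinfun_apply (G - F) ` {0..x})"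
proof -
  obtain s where s: "F \<le> s" "G \<le> s" "\<And>h. F \<le> h \<Longrightarrow> G \<le> h \<Longrightarrow> s \<le> h"
    "\<And>x. 0 \<le> x \<Longrightarrow> coord (blinfun_apply s x) =
         coord (blinfun_apply F x) + Sup ((\<lambda>y. coord (blinfun_apply (G - F) y)) ` {0..x})"
    using sup_blinfun_exists[of F G] by blast
  have "sup F G = s" using s(1-3) by (intro order.antisym) auto
  with s(4)[OF assms] show ?thesis by simp
qed

text \<open>The Riesz-Kantorovich formula: up to \<open>e\<close>, the supremum of two functionals at \<open>x\<close> is attained by
splitting \<open>x\<close> into a part evaluated by \<open>F\<close> and a part evaluated by \<open>G\<close>. The case \<open>G = - F\<close>
describes moduli, the case \<open>inf F G = 0\<close> disjoint functionals.\<close>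

lemma sup_apply_approx:
  fixes F G :: "'a::banach_lattice \<Rightarrow>\<^sub>L real"
  assumes "0 \<le> x" "0 < e"
  shows "\<exists>y. 0 \<le> y \<and> y \<le> x \<and> blinfun_apply (sup F G) x < F (x - y) + G y + e"
proof -
  have "Sup (blinfun_apply (G - F) ` {0..x}) - e < Sup (blinfun_apply (G - F) ` {0..x})"
    using assms by simp
  with assms(1) obtain z where "z \<in> blinfun_apply (G - F) ` {0..x}"
    "Sup (blinfun_apply (G - F) ` {0..x}) - e < z"
    using less_cSupD[of "blinfun_apply (G - F) ` {0..x}"] by force
  then obtain y where y: "0 \<le> y" "y \<le> x"
    "Sup (blinfun_apply (G - F) ` {0..x}) - e < blinfun_apply (G - F) y"
    by auto
  have "blinfun_apply (G - F) y = G y - F y" by (rule blinfun.diff_left)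
  moreover have "F (x - y) = F x - F y" by (rule blinfun.diff_right)
  ultimately have "blinfun_apply (sup F G) x < F (x - y) + G y + e"
    using blinfun_sup_apply[OF assms(1), of F G] y(3) by linarith
  thus ?thesis using y by blast
qed

lemma abs_apply_approx:
  fixes F :: "'a::banach_lattice \<Rightarrow>\<^sub>L real"
  assumes "0 \<le> x" "0 < e"
  shows "\<exists>v. \<bar>v\<bar> \<le> x \<and> blinfun_apply \<bar>F\<bar> x < F v + e"
proof -
  obtain y where y: "0 \<le> y" "y \<le> x"
    "blinfun_apply (sup F (- F)) x < F (x - y) + blinfun_apply (- F) y + e"
    using sup_apply_approx[OF assms, of F "- F"] by blast
  have "\<bar>x - y - y\<bar> \<le> x"
  proof (rule abs_leI)
    show "x - y - y \<le> x" using y by (simp add: algebra_simps)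
    have "y + y \<le> x + x" using y by (intro add_mono)
    thus "- (x - y - y) \<le> x" by (simp add: algebra_simps)
  qed
  thus ?thesis using y
    by (intro exI[of _ "x - y - y"]) (simp add: abs_lattice blinfun.bilinear_simps)
qed

lemma abs_blinfun_apply_le:
  fixes F :: "'a::banach_lattice \<Rightarrow>\<^sub>L real"
  assumes "\<bar>v\<bar> \<le> x"
  shows "\<bar>F v\<bar> \<le> blinfun_apply \<bar>F\<bar> x"
proof -
  have le: "F u \<le> blinfun_apply \<bar>F\<bar> u" "- F u \<le> blinfun_apply \<bar>F\<bar> u" if "0 \<le> u" for u
    using that abs_ge_self[of F] abs_ge_minus_self[of F]
    by (auto simp: less_eq_blinfun_def blinfun.minus_left)
  have "F v = F (pprt v) + F (nprt v)" by (metis prts blinfun.add_right)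
  also have "\<bar>\<dots>\<bar> \<le> blinfun_apply \<bar>F\<bar> (pprt v) + blinfun_apply \<bar>F\<bar> (- nprt v)"
    using le[of "pprt v"] le[of "- nprt v"] by (simp add: blinfun.minus_right)
  also have "\<dots> = blinfun_apply \<bar>F\<bar> \<bar>v\<bar>"
    by (simp add: abs_prts blinfun.bilinear_simps)
  also have "\<dots> \<le> blinfun_apply \<bar>F\<bar> x" using assms by (intro blinfun_mono) auto
  finally show ?thesis .
qed

lemma abs_blinfun_leI:
  fixes F G :: "'a::banach_lattice \<Rightarrow>\<^sub>L real"
  assumes "\<And>x. 0 \<le> x \<Longrightarrow> \<bar>F x\<bar> \<le> G x"
  shows "\<bar>F\<bar> \<le> G"
proof (rule abs_leI)
  show "F \<le> G" "- F \<le> G"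
    using assms by (auto simp del: minus_diff_eq simp: less_eq_blinfun_def blinfun.minus_left abs_le_iff)
qed

text \<open>Disjoint functionals live on complementary parts of any positive vector, up to \<open>e\<close>. Exact
complementary parts need not exist, as the functionals are not assumed order continuous; this is what
makes the passage from pairs to sequences of functionals below delicate.\<close>

lemma disjoint_apply_approx:
  fixes F G :: "'a::banach_lattice \<Rightarrow>\<^sub>L real"
  assumes "inf F G = 0" "0 \<le> x" "0 < e"
  shows "\<exists>u. 0 \<le> u \<and> u \<le> x \<and> F (x - u) + G u < e"
proof -
  obtain y where y: "0 \<le> y" "y \<le> x" "blinfun_apply (sup F G) x < F (x - y) + G y + e"
    using sup_apply_approx[OF assms(2,3), of F G] by blast
  have "sup F G = F + G" using add_eq_inf_sup[of F G] assms(1) by simp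
  thus ?thesis using y
    by (intro exI[of _ "x - y"]) (auto simp: blinfun.bilinear_simps)
qed

text \<open>Every functional is dominated by its modulus, so weak nullity can be tested on moduli and positive
functionals.\<close>

lemma weakly_null_absI:
  fixes y :: "nat \<Rightarrow> 'a::banach_lattice"
  assumes "\<And>f :: 'a \<Rightarrow>\<^sub>L real. 0 \<le> f \<Longrightarrow> (\<lambda>n. blinfun_apply f \<bar>y n\<bar>) \<longlonglongrightarrow> 0"
  shows "weakly_null y"
  unfolding weakly_null_iff
proof
  fix f :: "'a \<Rightarrow>\<^sub>L real"
  show "(\<lambda>n. f (y n)) \<longlonglongrightarrow> 0"
  proof (rule Lim_null_comparison)
    show "\<forall>\<^sub>F n in sequentially. norm (f (y n)) \<le> blinfun_apply \<bar>f\<bar> \<bar>y n\<bar>"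
      using abs_blinfun_apply_le[of "y _" "\<bar>y _\<bar>" f] by simp
  qed (rule assms, simp)
qed

lemma less_norm_attained:
  fixes F :: "'a::real_normed_vector \<Rightarrow>\<^sub>L real"
  assumes "0 \<le> e" "e < norm F"
  shows "\<exists>x. norm x \<le> 1 \<and> e < \<bar>F x\<bar>"
proof (rule ccontr)
  assume "\<not> ?thesis"
  hence le: "norm x \<le> 1 \<Longrightarrow> \<bar>F x\<bar> \<le> e" for x by (meson not_le)
  have "norm F \<le> e"
  proof (rule norm_blinfun_bound)
    show "norm (F x) \<le> e * norm x" for x
      using le[of "x /\<^sub>R norm x"] by (cases "x = 0") (simp_all add: blinfun.scaleR_right abs_mult field_simps)
  qed fact
  thus False using assms by simp
qed

lemma blinfun_of_linear:
  assumes "linear L" "\<And>x. \<bar>L x\<bar> \<le> norm x * K"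
  obtains F :: "'a::real_normed_vector \<Rightarrow>\<^sub>L real" where "\<And>x. F x = L x"
proof -
  have "bounded_linear L"
    using assms by (intro bounded_linear_intro[where K = K]) (auto simp: linear_add linear_scale)
  thus thesis using that bounded_linear_Blinfun_apply by metis
qed

section \<open>The Hahn-Banach theorem and its lattice consequences\<close>

definition sublinear :: "('a::real_vector \<Rightarrow> real) \<Rightarrow> bool" where
  "sublinear p \<longleftrightarrow> (\<forall>x y. p (x + y) \<le> p x + p y) \<and> (\<forall>t>0. \<forall>x. p (t *\<^sub>R x) = t * p x)"

lemma sublinear_zero:
  assumes "sublinear p"
  shows "p 0 = 0"
proof -
  have "p (2 *\<^sub>R 0) = 2 * p 0"
    using assms unfolding sublinear_def by (meson zero_less_numeral)
  thus ?thesis by simp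
qed

lemma sublinear_minus: assumes "sublinear p" shows "- p (- x) \<le> p x"
proof -
  have "p (x + - x) \<le> p x + p (- x)" using assms unfolding sublinear_def by blast
  thus ?thesis using sublinear_zero[OF assms] by simp
qed

text \<open>Tilting \<open>p\<close> along the ray through \<open>y\<close> yields a sublinear minorant. It serves twice: it produces
the prescribed value at \<open>y\<close> in the Hahn-Banach theorem, and it shows that a minimal sublinear
functional is additive.\<close>

lemma sublinear_tilt:
  fixes p :: "'a::real_vector \<Rightarrow> real" and y :: 'a
  assumes p: "sublinear p"
  obtains q where "sublinear q" "\<And>x. q x \<le> p x" "\<And>x. q x \<le> p (x + y) - p y"
proof -
  define q where "q = (\<lambda>x. INF t\<in>{0..}. p (x + t *\<^sub>R y) - t * p y)"
  have sub: "p (x + z) \<le> p x + p z" for x z using p by (simp add: sublinear_def)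
  have hom: "0 < t \<Longrightarrow> p (t *\<^sub>R x) = t * p x" for t x using p by (simp add: sublinear_def)
  have hom0: "0 \<le> t \<Longrightarrow> p (t *\<^sub>R x) = t * p x" for t x
    using hom[of t x] sublinear_zero[OF p] by (cases "t = 0") auto
  have bdd: "bdd_below ((\<lambda>t. p (x + t *\<^sub>R y) - t * p y) ` {0..})" for x
  proof (rule bdd_belowI2)
    fix t :: real assume "t \<in> {0..}"
    hence "t * p y = p (t *\<^sub>R y)" by (simp add: hom0)
    also have "\<dots> \<le> p (x + t *\<^sub>R y) + p (- x)" using sub[of "x + t *\<^sub>R y" "- x"] by simp
    finally show "- p (- x) \<le> p (x + t *\<^sub>R y) - t * p y" by simp
  qed
  have le: "q x \<le> p (x + t *\<^sub>R y) - t * p y" if "0 \<le> t" for x t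
    unfolding q_def using bdd that by (intro cINF_lower) auto
  have ge: "c \<le> q x" if "\<And>t. 0 \<le> t \<Longrightarrow> c \<le> p (x + t *\<^sub>R y) - t * p y" for c x
    unfolding q_def using that by (intro cINF_greatest) auto
  have scale: "q (s *\<^sub>R x) \<ge> s * q x" if s: "0 < s" for s x
  proof (rule ge)
    fix t :: real assume t: "0 \<le> t"
    have "s * q x \<le> s * (p (x + (t / s) *\<^sub>R y) - (t / s) * p y)"
      using s t by (intro mult_left_mono le) auto
    also have "\<dots> = s * p (x + (t / s) *\<^sub>R y) - t * p y"
      using s by (simp add: right_diff_distrib)
    also have "s * p (x + (t / s) *\<^sub>R y) = p (s *\<^sub>R x + t *\<^sub>R y)"
      using s by (simp add: hom[symmetric] scaleR_add_right)
    finally show "s * q x \<le> p (s *\<^sub>R x + t *\<^sub>R y) - t * p y" .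
  qed
  have "sublinear q" unfolding sublinear_def
  proof (intro conjI allI impI)
    fix x z
    have "q (x + z) - (p (z + s *\<^sub>R y) - s * p y) \<le> q x" if s: "0 \<le> s" for s
    proof (rule ge)
      fix t :: real assume t: "0 \<le> t"
      have "q (x + z) \<le> p ((x + z) + (t + s) *\<^sub>R y) - (t + s) * p y" using s t by (intro le) simp
      also have "p ((x + z) + (t + s) *\<^sub>R y) \<le> p (x + t *\<^sub>R y) + p (z + s *\<^sub>R y)"
        using sub[of "x + t *\<^sub>R y" "z + s *\<^sub>R y"] by (simp add: algebra_simps)
      finally show "q (x + z) - (p (z + s *\<^sub>R y) - s * p y) \<le> p (x + t *\<^sub>R y) - t * p y"
        by (simp add: algebra_simps)
    qed
    hence "q (x + z) - q x \<le> q z" by (intro ge) (simp add: algebra_simps)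
    thus "q (x + z) \<le> q x + q z" by simp
  next
    fix s :: real and x assume s: "0 < s"
    have "inverse s * q (s *\<^sub>R x) \<le> q (inverse s *\<^sub>R (s *\<^sub>R x))" using s by (intro scale) simp
    hence "q (s *\<^sub>R x) \<le> s * q x" using s by (simp add: field_simps)
    with scale[OF s] show "q (s *\<^sub>R x) = s * q x" by (rule order.antisym[rotated])
  qed
  moreover have "q x \<le> p x" for x using le[of 0 x] by simp
  moreover have "q x \<le> p (x + y) - p y" for x using le[of 1 x] by simp
  ultimately show thesis by (rule that)
qed

text \<open>Zorn's lemma gives a minimal sublinear functional below a tilt of \<open>p\<close>. Minimality makes it equal to
all of its own tilts, and therefore additive. Starting from the tilt along \<open>y\<close> rather than from \<open>p\<close>
itself forces the value at \<open>- y\<close> down to \<open>- p y\<close>.\<close>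

theorem hahn_banach_sublinear:
  fixes p :: "'a::real_vector \<Rightarrow> real"
  assumes p: "sublinear p"
  obtains L where "linear L" "\<And>x. L x \<le> p x" "L y = p y"
proof -
  obtain p' where p': "sublinear p'" "\<And>x. p' x \<le> p x" "\<And>x. p' x \<le> p (x + y) - p y"
    using sublinear_tilt[OF p] by blast
  define A where "A = {q. sublinear q \<and> (\<forall>x. q x \<le> p' x)}"
  define P where "P = (\<lambda>q r :: 'a \<Rightarrow> real. \<forall>x. r x \<le> q x)"
  have "\<exists>m\<in>A. \<forall>a\<in>A. P m a \<longrightarrow> a = m"
  proof (rule predicate_Zorn)
    show "partial_order_on A (relation_of P A)"
      by (rule partial_order_on_relation_ofI) (auto simp: P_def fun_eq_iff intro: order_trans order.antisym)
    fix C assume C: "C \<in> Chains (relation_of P A)"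
    show "\<exists>u\<in>A. \<forall>a\<in>C. P a u"
    proof (cases "C = {}")
      case True
      thus ?thesis using p' by (auto simp: A_def)
    next
      case False
      have CA: "C \<subseteq> A" using C by (auto simp: Chains_def relation_of_def)
      have ch: "P a b \<or> P b a" if "a \<in> C" "b \<in> C" for a b
        using C that by (auto simp: Chains_def relation_of_def)
      define u where "u = (\<lambda>x. INF q\<in>C. q x)"
      have bdd: "bdd_below ((\<lambda>q. q x) ` C)" for x
      proof (rule bdd_belowI2)
        fix q assume "q \<in> C"
        with CA have q: "sublinear q" "q (- x) \<le> p' (- x)" by (auto simp: A_def)
        from sublinear_minus[OF q(1), of x] q(2) show "- p' (- x) \<le> q x" by simp
      qed
      have le: "u x \<le> q x" if "q \<in> C" for q x
        unfolding u_def using bdd that by (intro cINF_lower) auto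
      have ge: "c \<le> u x" if "\<And>q. q \<in> C \<Longrightarrow> c \<le> q x" for c x
        unfolding u_def using that False by (intro cINF_greatest) auto
      have scale: "s * u x \<le> u (s *\<^sub>R x)" if s: "0 < s" for s x
      proof (rule ge)
        fix q assume q: "q \<in> C"
        with CA have "sublinear q" by (auto simp: A_def)
        with s have "q (s *\<^sub>R x) = s * q x" by (simp add: sublinear_def)
        thus "s * u x \<le> q (s *\<^sub>R x)" using s le[OF q, of x] by simp
      qed
      have "sublinear u" unfolding sublinear_def
      proof (intro conjI allI impI)
        fix x z
        have "u (x + z) - r z \<le> q x" if qr: "q \<in> C" "r \<in> C" for q r
        proof -
          obtain m where m: "m \<in> C" "m x \<le> q x" "m z \<le> r z"
            using ch[OF qr] qr unfolding P_def by (meson order_refl)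
          have "u (x + z) \<le> m (x + z)" by (rule le[OF m(1)])
          also have "\<dots> \<le> m x + m z" using m(1) CA by (auto simp: A_def sublinear_def)
          finally show ?thesis using m by simp
        qed
        hence "u (x + z) - r z \<le> u x" if "r \<in> C" for r using that by (intro ge)
        hence "u (x + z) - u x \<le> u z" by (intro ge) (simp add: algebra_simps)
        thus "u (x + z) \<le> u x + u z" by simp
      next
        fix s :: real and x assume s: "0 < s"
        have "inverse s * u (s *\<^sub>R x) \<le> u (inverse s *\<^sub>R (s *\<^sub>R x))" using s by (intro scale) simp
        hence "u (s *\<^sub>R x) \<le> s * u x" using s by (simp add: field_simps)
        with scale[OF s] show "u (s *\<^sub>R x) = s * u x" by (rule order.antisym[rotated])
      qed
      moreover have "u x \<le> p' x" for x
        using False CA le by (force simp: A_def intro: order_trans)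
      ultimately show ?thesis using le by (auto simp: A_def P_def)
    qed
  qed
  then obtain L where L: "sublinear L" "\<And>x. L x \<le> p' x"
    "\<And>q. sublinear q \<Longrightarrow> (\<And>x. q x \<le> p' x) \<Longrightarrow> (\<And>x. q x \<le> L x) \<Longrightarrow> q = L"
    by (auto simp: A_def P_def)
  have add: "L (x + z) = L x + L z" for x z
  proof (rule order.antisym)
    show "L (x + z) \<le> L x + L z" using L(1) by (simp add: sublinear_def)
    obtain q where t: "sublinear q" "\<And>x. q x \<le> L x" "\<And>x. q x \<le> L (x + z) - L z"
      using sublinear_tilt[OF L(1)] by blast
    have "q = L" by (rule L(3)[OF t(1) order_trans[OF t(2) L(2)] t(2)])
    with t(3)[of x] show "L x + L z \<le> L (x + z)" by simp
  qed
  have neg: "L (- x) = - L x" for x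
    using add[of x "- x"] sublinear_zero[OF L(1)] by simp
  have pos: "0 < t \<Longrightarrow> L (t *\<^sub>R x) = t * L x" for t x using L(1) by (simp add: sublinear_def)
  have "L (t *\<^sub>R x) = t * L x" for t x
    using pos[of t x] pos[of "- t" x] neg[of "t *\<^sub>R x"] sublinear_zero[OF L(1)]
    by (cases t "0::real" rule: linorder_cases) auto
  hence "linear L" using add by (intro linearI) auto
  moreover have "L x \<le> p x" for x using L(2) p'(2) order_trans by blast
  moreover have "L y = p y"
  proof (rule order.antisym)
    show "L y \<le> p y" by (rule \<open>\<And>x. L x \<le> p x\<close>)
    have "L (- y) \<le> p (- y + y) - p y" using L(2)[of "- y"] p'(3)[of "- y"] by (rule order_trans)
    thus "p y \<le> L y" using neg[of y] sublinear_zero[OF p] by simp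
  qed
  ultimately show thesis by (rule that)
qed

text \<open>Hahn-Banach for the seminorm \<open>\<lambda>z. f \<bar>z\<bar>\<close>: the functionals that it dominates are exactly those whose
modulus is at most \<open>f\<close>.\<close>

lemma apply_abs_attained:
  fixes f :: "'a::banach_lattice \<Rightarrow>\<^sub>L real"
  assumes f: "0 \<le> f"
  obtains g :: "'a \<Rightarrow>\<^sub>L real" where "\<bar>g\<bar> \<le> f" "f \<bar>y\<bar> = g y"
proof -
  have "sublinear (\<lambda>z. f \<bar>z\<bar>)" unfolding sublinear_def
  proof (intro conjI allI impI)
    show "f \<bar>x + z\<bar> \<le> f \<bar>x\<bar> + f \<bar>z\<bar>" for x z
      using blinfun_mono[OF f abs_triangle_ineq, of x z] by (simp add: blinfun.add_right)
  qed (simp add: abs_scaleR_pos blinfun.scaleR_right)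
  from hahn_banach_sublinear[OF this, of y] obtain L where
    L: "linear L" "\<And>x. L x \<le> f \<bar>x\<bar>" "L y = f \<bar>y\<bar>" by blast
  have L': "\<bar>L x\<bar> \<le> f \<bar>x\<bar>" for x
    using L(2)[of x] L(2)[of "- x"] linear_neg[OF L(1), of x] by simp
  have "\<bar>L x\<bar> \<le> norm x * norm f" for x
    using L'[of x] norm_blinfun[of f "\<bar>x\<bar>"] by (simp add: mult.commute)
  from blinfun_of_linear[OF L(1) this] obtain g :: "'a \<Rightarrow>\<^sub>L real" where g: "\<And>x. g x = L x" by blast
  show thesis
  proof
    show "f \<bar>y\<bar> = g y" by (simp add: g L)
    show "\<bar>g\<bar> \<le> f"
    proof (rule abs_leI)
      have "\<bar>g x\<bar> \<le> f x" if "0 \<le> x" for x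
        using L'[of x] that by (simp add: g abs_of_nonneg)
      thus "g \<le> f" "- g \<le> f"
        by (auto simp: less_eq_blinfun_def blinfun.minus_left abs_le_iff)
    qed
  qed
qed

text \<open>The order of a Banach lattice is determined by its positive functionals. Hahn-Banach is applied to
\<open>\<lambda>z. norm (pprt z)\<close>, whose linear minorants are all positive.\<close>

lemma nonneg_if_functionals_nonneg:
  fixes y :: "'a::banach_lattice"
  assumes "\<And>f :: 'a \<Rightarrow>\<^sub>L real. 0 \<le> f \<Longrightarrow> 0 \<le> blinfun_apply f y"
  shows "0 \<le> y"
proof -
  have "sublinear (\<lambda>z::'a. norm (pprt z))" unfolding sublinear_def
  proof (intro conjI allI impI)
    fix x z :: 'a
    have "norm (pprt (x + z)) \<le> norm (pprt x + pprt z)"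
      by (intro norm_mono_pos pprt_add_le) simp
    thus "norm (pprt (x + z)) \<le> norm (pprt x) + norm (pprt z)"
      using norm_triangle_ineq order_trans by blast
  qed (simp add: pprt_scaleR)
  from hahn_banach_sublinear[OF this, of "- y"] obtain L where
    L: "linear L" "\<And>x. L x \<le> norm (pprt x)" "L (- y) = norm (pprt (- y))" by blast
  have "\<bar>L x\<bar> \<le> norm x * 1" for x
    using order_trans[OF L(2)[of x] norm_pprt_le] order_trans[OF L(2)[of "- x"] norm_pprt_le] linear_neg[OF L(1), of x]
    by simp
  from blinfun_of_linear[OF L(1) this] obtain f :: "'a \<Rightarrow>\<^sub>L real" where f: "\<And>x. f x = L x" by blast
  have "0 \<le> f" unfolding less_eq_blinfun_def
  proof (intro allI impI)
    fix x :: 'a assume "0 \<le> x"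
    thus "blinfun_apply 0 x \<le> f x" using L(2)[of "- x"] f linear_neg[OF L(1), of x] by simp
  qed
  from assms[OF this] have "norm (pprt (- y)) \<le> 0"
    using L(3) f[of y] linear_neg[OF L(1), of y] by linarith
  hence "pprt (- y) = 0" by simp
  thus ?thesis by (metis le_zero_iff_zero_pprt neg_le_0_iff_le)
qed

section \<open>Weakly compact operators map the bidual into the range space\<close>

lemma dual_op_apply: "blinfun_apply (dual_op T) f = f o\<^sub>L T"
  by (simp add: dual_op.rep_eq)

text \<open>A finite-dimensional form of Goldstine's theorem: on finitely many functionals, an element of the
bidual ball is approximated by elements of the ball. The proof is a least-squares argument. At an
almost minimal point \<open>x\<close>, the first-order condition says that the residual functional
\<open>\<Sum>\<phi>\<in>I. (F \<phi> - \<phi> x) *\<^sub>R \<phi>\<close> almost attains its norm at \<open>x\<close>, and then the difference between its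
values at \<open>F\<close> and at \<open>x\<close>, which is the sum of the squared residuals, must be small.\<close>

lemma goldstine_finite:
  fixes F :: "('a::real_normed_vector \<Rightarrow>\<^sub>L real) \<Rightarrow>\<^sub>L real"
  assumes F: "norm F \<le> 1" and I: "finite I" and e: "0 < e"
  shows "\<exists>x. norm x \<le> 1 \<and> (\<Sum>\<phi>\<in>I. (F \<phi> - blinfun_apply \<phi> x)\<^sup>2) \<le> e"
proof -
  define Q where "Q x = (\<Sum>\<phi>\<in>I. (F \<phi> - blinfun_apply \<phi> x)\<^sup>2)" for x
  define M where "M = (\<Sum>\<phi>\<in>I. (2 * norm \<phi>)\<^sup>2)"
  have M: "0 \<le> M" unfolding M_def by (intro sum_nonneg) simp
  define s where "s = min 1 (2 * e / (1 + M))"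
  have s: "0 < s" "s \<le> 1" using e M by (simp_all add: s_def)
  have "s * (1 + M) \<le> 2 * e / (1 + M) * (1 + M)"
    using M by (intro mult_right_mono) (simp_all add: s_def)
  hence sM: "s * (1 + M) \<le> 2 * e" using M by simp
  define d where "d = (INF x\<in>cball 0 1. Q x)"
  have bdd: "bdd_below (Q ` cball 0 1)"
    unfolding Q_def by (intro bdd_belowI2[where m = 0] sum_nonneg) simp
  have d: "d \<le> Q x" if "norm x \<le> 1" for x
    unfolding d_def using that by (intro cINF_lower bdd) simp
  have "\<exists>x\<in>cball 0 1. Q x < d + s\<^sup>2"
    using s(1) cINF_less_iff[OF _ bdd, of "d + s\<^sup>2"] unfolding d_def by simp
  then obtain x where x: "norm x \<le> 1" "Q x < d + s\<^sup>2" by auto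
  define c where "c \<phi> = F \<phi> - blinfun_apply \<phi> x" for \<phi>
  define \<Phi> where "\<Phi> = (\<Sum>\<phi>\<in>I. c \<phi> *\<^sub>R \<phi>)"
  define h where "h = s * (1 + M) / 2"
  have \<Phi>: "blinfun_apply \<Phi> z = (\<Sum>\<phi>\<in>I. c \<phi> * blinfun_apply \<phi> z)" for z
    by (simp add: \<Phi>_def blinfun.sum_left blinfun.scaleR_left)
  \<comment> \<open>The first-order condition: as \<open>x\<close> minimises \<open>Q\<close> up to \<open>s\<^sup>2\<close>, a step of length \<open>s\<close> towards \<open>z\<close>
    gains at most \<open>s\<^sup>2\<close>, and its linear part is thus of order \<open>s\<^sup>2\<close> as well.\<close>
  have ball: "\<Phi> z \<le> \<Phi> x + h" if z: "norm z \<le> 1" for z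
  proof -
    have "norm (x + s *\<^sub>R (z - x)) \<le> 1"
    proof -
      have "x + s *\<^sub>R (z - x) = (1 - s) *\<^sub>R x + s *\<^sub>R z" by (simp add: algebra_simps)
      hence "norm (x + s *\<^sub>R (z - x)) \<le> (1 - s) * norm x + s * norm z"
        using s norm_triangle_ineq[of "(1 - s) *\<^sub>R x" "s *\<^sub>R z"] by simp
      also have "\<dots> \<le> (1 - s) * 1 + s * 1" using s x z by (intro add_mono mult_left_mono) auto
      finally show ?thesis by simp
    qed
    hence "d \<le> Q (x + s *\<^sub>R (z - x))" by (rule d)
    also have "\<dots> = (\<Sum>\<phi>\<in>I. (c \<phi>)\<^sup>2 - 2 * s * (c \<phi> * blinfun_apply \<phi> (z - x))
        + s\<^sup>2 * (blinfun_apply \<phi> (z - x))\<^sup>2)"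
      unfolding Q_def c_def
      by (intro sum.cong refl) (simp add: blinfun.bilinear_simps power2_eq_square algebra_simps)
    also have "\<dots> = Q x - 2 * s * \<Phi> (z - x) + s\<^sup>2 * (\<Sum>\<phi>\<in>I. (blinfun_apply \<phi> (z - x))\<^sup>2)"
      by (simp add: \<Phi> Q_def c_def sum.distrib sum_subtractf sum_distrib_left)
    also have "(\<Sum>\<phi>\<in>I. (blinfun_apply \<phi> (z - x))\<^sup>2) \<le> M"
      unfolding M_def
    proof (intro sum_mono)
      fix \<phi> :: "'a \<Rightarrow>\<^sub>L real"
      have "\<bar>blinfun_apply \<phi> (z - x)\<bar> \<le> norm \<phi> * norm (z - x)"
        using norm_blinfun[of \<phi> "z - x"] by simp
      also have "\<dots> \<le> norm \<phi> * 2"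
        using norm_triangle_ineq4[of z x] x z by (intro mult_left_mono) auto
      finally show "(blinfun_apply \<phi> (z - x))\<^sup>2 \<le> (2 * norm \<phi>)\<^sup>2"
        by (subst abs_le_square_iff[symmetric]) (simp add: mult.commute)
    qed
    finally have "2 * s * \<Phi> (z - x) \<le> s\<^sup>2 + s\<^sup>2 * M"
      using x s by (simp add: mult_left_mono)
    also have "\<dots> = s * (2 * h)" by (simp add: h_def power2_eq_square algebra_simps)
    finally have "\<Phi> (z - x) \<le> h" using s by simp
    thus ?thesis by (simp add: blinfun.diff_right)
  qed
  have "norm \<Phi> \<le> \<Phi> x + h"
  proof (rule norm_blinfun_bound)
    show "0 \<le> \<Phi> x + h" using ball[of 0] by simp
    show "norm (\<Phi> z) \<le> (\<Phi> x + h) * norm z" for z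
    proof (cases "z = 0")
      case False
      have "\<Phi> (z /\<^sub>R norm z) \<le> \<Phi> x + h" "\<Phi> (- z /\<^sub>R norm z) \<le> \<Phi> x + h"
        using False by (intro ball; simp)+
      hence "\<bar>\<Phi> z\<bar> / norm z \<le> \<Phi> x + h"
        by (cases "0 \<le> \<Phi> z") (simp_all add: blinfun.bilinear_simps field_simps)
      thus ?thesis using False by (simp add: field_simps)
    qed simp
  qed
  have "F \<Phi> \<le> norm F * norm \<Phi>" using norm_blinfun[of F \<Phi>] by simp
  also have "\<dots> \<le> 1 * norm \<Phi>" using F by (intro mult_right_mono) auto
  also have "\<dots> \<le> \<Phi> x + h" using \<open>norm \<Phi> \<le> \<Phi> x + h\<close> by simp
  finally have "F \<Phi> - \<Phi> x \<le> h" by simp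
  moreover have "F \<Phi> - \<Phi> x = Q x"
  proof -
    have "F \<Phi> = (\<Sum>\<phi>\<in>I. c \<phi> * F \<phi>)"
      by (simp add: \<Phi>_def blinfun.sum_right blinfun.scaleR_right)
    hence "F \<Phi> - \<Phi> x = (\<Sum>\<phi>\<in>I. c \<phi> * c \<phi>)"
      by (simp add: \<Phi> c_def sum_subtractf right_diff_distrib)
    thus ?thesis by (simp add: Q_def c_def power2_eq_square)
  qed
  ultimately have "Q x \<le> e" using sM by (simp add: h_def)
  thus ?thesis using x unfolding Q_def by blast
qed

lemma closedin_weak_strip:
  fixes f :: "'a::real_normed_vector \<Rightarrow>\<^sub>L real"
  shows "closedin weak_topology {y. \<bar>f y - a\<bar> \<le> e}"
proof -
  have "continuous_map euclidean euclidean (\<lambda>h :: ('a \<Rightarrow>\<^sub>L real) \<Rightarrow> real. h f)"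
    by (simp add: continuous_on_product_coordinates)
  hence "continuous_map weak_topology euclidean ((\<lambda>h. h f) \<circ> (\<lambda>x (g :: 'a \<Rightarrow>\<^sub>L real). g x))"
    unfolding weak_topology_def by (rule continuous_map_pullback)
  hence "continuous_map weak_topology euclidean (\<lambda>y. f y)" by (simp add: o_def)
  from closedin_continuous_map_preimage[OF this, of "cball a e"]
  have "closedin weak_topology {y \<in> topspace weak_topology. f y \<in> cball a e}" by simp
  also have "{y \<in> topspace weak_topology. f y \<in> cball a e} = {y. \<bar>f y - a\<bar> \<le> e}"
    by (auto simp: weak_topology_def topspace_pullback_topology dist_real_def)
  finally show ?thesis .
qed

text \<open>Gantmacher's theorem. For \<open>F\<close> in the unit ball of the bidual, the sets of all \<open>y\<close> at which finitely
many functionals \<open>f\<close> take almost the value \<open>F (dual_op T f)\<close> are weakly closed and meet the image of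
the unit ball, by Goldstine. By weak compactness they have a common point.\<close>

theorem weakly_compact_bidual:
  fixes T :: "'a::banach \<Rightarrow>\<^sub>L 'b::banach" and F :: "('a \<Rightarrow>\<^sub>L real) \<Rightarrow>\<^sub>L real"
  assumes T: "weakly_compact_op T"
  shows "\<exists>y. \<forall>f. F (dual_op T f) = blinfun_apply f y"
proof -
  have *: "\<exists>y. \<forall>f. F (dual_op T f) = blinfun_apply f y" if F: "norm F \<le> 1"
    for F :: "('a \<Rightarrow>\<^sub>L real) \<Rightarrow>\<^sub>L real"
  proof -
    define K where "K = weak_topology closure_of (blinfun_apply T ` cball 0 1)"
    define S where "S = (\<lambda>(f, e). {y. \<bar>blinfun_apply f y - F (dual_op T f)\<bar> \<le> e})"
    have top: "topspace weak_topology = (UNIV :: 'b set)"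
      by (simp add: weak_topology_def topspace_pullback_topology)
    have "K \<inter> \<Inter>(S ` (UNIV \<times> {0<..})) \<noteq> {}"
    proof -
      have "\<forall>\<U>. (\<forall>C\<in>\<U>. closedin weak_topology C) \<and>
          (\<forall>\<F>. finite \<F> \<and> \<F> \<subseteq> \<U> \<longrightarrow> K \<inter> \<Inter>\<F> \<noteq> {}) \<longrightarrow> K \<inter> \<Inter>\<U> \<noteq> {}"
        using T unfolding weakly_compact_op_def K_def[symmetric] compactin_fip by blast
      moreover have "\<forall>C\<in>S ` (UNIV \<times> {0<..}). closedin weak_topology C"
        unfolding S_def by (auto intro: closedin_weak_strip)
      moreover have "K \<inter> \<Inter>\<F> \<noteq> {}"
        if fin: "finite \<F>" and sub: "\<F> \<subseteq> S ` (UNIV \<times> {0<..})" for \<F>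
      proof -
        obtain J where J: "finite J" "J \<subseteq> UNIV \<times> {0<..}" "\<F> = S ` J"
          using finite_subset_image[OF fin sub] by blast
        define e where "e = Min (insert 1 (snd ` J))"
        have e: "0 < e" "\<And>f r. (f, r) \<in> J \<Longrightarrow> e \<le> r"
          using J by (force simp: e_def Min_gr_iff, force simp: e_def intro!: Min_le)
        define I where "I = (\<lambda>(f, r). dual_op T f) ` J"
        have I: "finite I" using J by (simp add: I_def)
        obtain x where x: "norm x \<le> 1" "(\<Sum>\<phi>\<in>I. (F \<phi> - blinfun_apply \<phi> x)\<^sup>2) \<le> e\<^sup>2"
          using goldstine_finite[OF F I, of "e\<^sup>2"] e(1) by auto
        have "T x \<in> S j" if j: "j \<in> J" for j
        proof -
          obtain f r where fr: "j = (f, r)" by (cases j)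
          have "dual_op T f \<in> I" using j fr unfolding I_def by force
          hence "(F (dual_op T f) - blinfun_apply (dual_op T f) x)\<^sup>2
              \<le> (\<Sum>\<phi>\<in>I. (F \<phi> - blinfun_apply \<phi> x)\<^sup>2)"
            using I by (intro member_le_sum) auto
          also note x(2)
          finally have "\<bar>F (dual_op T f) - f (T x)\<bar> \<le> \<bar>e\<bar>"
            unfolding abs_le_square_iff by (simp add: dual_op_apply)
          also have "\<dots> \<le> r" using e j fr by auto
          finally show ?thesis unfolding S_def fr by (simp add: abs_minus_commute)
        qed
        moreover have "T x \<in> K"
        proof -
          have "T x \<in> T ` cball 0 1" using x by simp
          thus ?thesis unfolding K_def using closure_of_subset[of "T ` cball 0 1" weak_topology] top by blast
        qed
        ultimately show ?thesis using J by blast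
      qed
      ultimately show ?thesis by blast
    qed
    then obtain y where "\<And>f e. 0 < e \<Longrightarrow> y \<in> S (f, e)" by fastforce
    hence y: "\<bar>f y - F (dual_op T f)\<bar> \<le> e" if "0 < e" for f :: "'b \<Rightarrow>\<^sub>L real" and e
      using that by (simp add: S_def)
    have "F (dual_op T f) = f y" for f :: "'b \<Rightarrow>\<^sub>L real"
      using field_le_epsilon[of "\<bar>f y - F (dual_op T f)\<bar>" 0] y[of _ f] by simp
    thus ?thesis by blast
  qed
  define r where "r = norm F + 1"
  have r: "0 < r" "norm (F /\<^sub>R r) \<le> 1" by (auto simp: r_def field_simps add_pos_nonneg intro: add_nonneg_pos)
  from *[OF r(2)] obtain y where y: "\<forall>f. (F /\<^sub>R r) (dual_op T f) = blinfun_apply f y" by blast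
  have "F (dual_op T f) = blinfun_apply f (r *\<^sub>R y)" for f
    using y[rule_format, of f] r(1) by (simp add: blinfun.bilinear_simps field_simps)
  thus ?thesis by blast
qed

section \<open>Positive functionals\<close>

text \<open>If the functionals \<open>h n\<close> were at least \<open>4 ^ n\<close> at positive vectors \<open>x n\<close> of the unit ball, then they would be
unbounded at the single vector \<open>\<Sum>n. (1 / 2) ^ n *\<^sub>R x n\<close>, which dominates each of its terms. For a
one-element family this is the automatic continuity of positive functionals.\<close>

theorem positive_functionals_bounded:
  fixes \<Phi> :: "('a::banach_lattice \<Rightarrow> real) set"
  assumes lin: "\<And>h. h \<in> \<Phi> \<Longrightarrow> linear h"
    and pos: "\<And>h x. h \<in> \<Phi> \<Longrightarrow> 0 \<le> x \<Longrightarrow> 0 \<le> h x"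
    and bdd: "\<And>x. 0 \<le> x \<Longrightarrow> \<exists>c. \<forall>h\<in>\<Phi>. h x \<le> c"
  shows "\<exists>C. \<forall>h\<in>\<Phi>. \<forall>x. \<bar>h x\<bar> \<le> norm x * C"
proof -
  have mono: "h x \<le> h y" if "h \<in> \<Phi>" "x \<le> y" for h x y
    using pos[OF that(1), of "y - x"] that linear_diff[OF lin[OF that(1)], of y x] by simp
  have "\<exists>n. \<forall>h\<in>\<Phi>. \<forall>x. 0 \<le> x \<longrightarrow> norm x \<le> 1 \<longrightarrow> h x \<le> 4 ^ n"
  proof (rule ccontr)
    assume "\<not> ?thesis"
    hence "\<forall>n. \<exists>h x. h \<in> \<Phi> \<and> 0 \<le> x \<and> norm x \<le> 1 \<and> 4 ^ n < h x" by (simp add: not_le) blast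
    then obtain h x where hx: "\<And>n. h n \<in> \<Phi>" "\<And>n. 0 \<le> x n" "\<And>n. norm (x n) \<le> 1"
      "\<And>n. (4::real) ^ n < h n (x n)" by metis
    define y where "y n = (1 / 2) ^ n *\<^sub>R x n" for n
    have "summable y"
    proof (rule summable_comparison_test')
      show "summable (\<lambda>n. (1 / 2) ^ n :: real)" by (simp add: summable_geometric)
      show "norm (y n) \<le> (1 / 2) ^ n" for n
        using hx(3)[of n] by (simp add: y_def mult_left_le)
    qed
    have y0: "0 \<le> y n" for n using hx(2) by (simp add: y_def scaleR_nonneg_nonneg)
    obtain c where c: "\<And>h. h \<in> \<Phi> \<Longrightarrow> h (suminf y) \<le> c"
      using bdd[of "suminf y"] order_trans[OF y0 le_suminf_nonneg[OF \<open>summable y\<close> y0]] by blast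
    have "2 ^ n \<le> c" for n
    proof -
      have "(2::real) ^ n = (1 / 2) ^ n * 4 ^ n" by (simp add: power_mult_distrib[symmetric])
      also have "\<dots> \<le> (1 / 2) ^ n * h n (x n)" using hx(4)[of n] by simp
      also have "\<dots> = h n (y n)" by (simp add: y_def linear_scale[OF lin[OF hx(1)]])
      also have "\<dots> \<le> h n (suminf y)"
        by (intro mono hx(1) le_suminf_nonneg \<open>summable y\<close> y0)
      also have "\<dots> \<le> c" by (rule c[OF hx(1)])
      finally show ?thesis .
    qed
    moreover obtain n where "c < 2 ^ n" using real_arch_pow[of 2 c] by auto
    ultimately show False by (meson not_le)
  qed
  then obtain n where n: "\<And>h x. h \<in> \<Phi> \<Longrightarrow> 0 \<le> x \<Longrightarrow> norm x \<le> 1 \<Longrightarrow> h x \<le> 4 ^ n" by blast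
  have "\<bar>h x\<bar> \<le> norm x * 4 ^ n" if h: "h \<in> \<Phi>" for h x
  proof (cases "x = 0")
    case True
    thus ?thesis using linear_0[OF lin[OF h]] by simp
  next
    case False
    have "h x \<le> h \<bar>x\<bar>" "h (- x) \<le> h \<bar>x\<bar>"
      by (rule mono[OF h], rule abs_ge_self, rule mono[OF h], rule abs_ge_minus_self)
    hence "\<bar>h x\<bar> \<le> h \<bar>x\<bar>" using linear_neg[OF lin[OF h], of x] by simp
    also have "h \<bar>x\<bar> = norm x * h (\<bar>x\<bar> /\<^sub>R norm x)"
      using False by (simp add: linear_scale[OF lin[OF h]])
    also have "\<dots> \<le> norm x * 4 ^ n"
      using False by (intro mult_left_mono n h) (auto simp: scaleR_nonneg_nonneg)
    finally show ?thesis .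
  qed
  thus ?thesis by blast
qed

text \<open>The dual of a Banach lattice is Dedekind complete. In the form needed for gliding humps: a series
whose terms are dominated by a positive series with bounded partial sums converges pointwise, and its
sum differs from the \<open>k\<close>-th term by no more than what \<open>w k\<close> leaves of the bound \<open>\<phi>\<close>.\<close>

lemma dual_order_series:
  fixes \<psi> w :: "nat \<Rightarrow> 'a::banach_lattice \<Rightarrow>\<^sub>L real"
  assumes \<psi>: "\<And>k. \<bar>\<psi> k\<bar> \<le> w k" and w: "\<And>n. (\<Sum>k<n. w k) \<le> \<phi>"
  shows "\<exists>s. (\<forall>x. (\<lambda>k. \<psi> k x) sums blinfun_apply s x) \<and> (\<forall>k. \<bar>s - \<psi> k\<bar> \<le> \<phi> - w k)"
proof -
  have w0: "0 \<le> w k" for k using \<psi>[of k] abs_ge_zero order_trans by blast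
  have w_le: "(\<Sum>k<n. w k x) \<le> \<phi> x" if "0 \<le> x" for x n
    using w[of n] that by (auto simp: less_eq_blinfun_def blinfun.sum_left)
  have \<psi>_le: "\<bar>\<psi> k x\<bar> \<le> w k \<bar>x\<bar>" for k x
  proof -
    have "\<bar>\<psi> k x\<bar> \<le> blinfun_apply \<bar>\<psi> k\<bar> \<bar>x\<bar>" by (rule abs_blinfun_apply_le) simp
    also have "\<dots> \<le> w k \<bar>x\<bar>" using \<psi>[of k] by (simp add: less_eq_blinfun_def)
    finally show ?thesis .
  qed
  have sum_w: "summable (\<lambda>k. w k \<bar>x\<bar>)" for x
    using w_le[of "\<bar>x\<bar>"] w0 by (intro summableI_nonneg_bounded[where x = "\<phi> \<bar>x\<bar>"]) (auto intro: blinfun_nonneg)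
  have summable: "summable (\<lambda>k. \<psi> k x)" for x
    using \<psi>_le by (intro summable_comparison_test'[OF sum_w[of x]]) simp
  define L where "L x = (\<Sum>k. \<psi> k x)" for x
  have "linear L"
    by (intro linearI)
       (simp_all add: L_def blinfun.add_right blinfun.scaleR_right suminf_add[symmetric] suminf_mult summable)
  moreover have "\<bar>L x\<bar> \<le> norm x * norm \<phi>" for x
  proof -
    have "\<bar>L x\<bar> \<le> (\<Sum>k. w k \<bar>x\<bar>)"
      unfolding L_def using norm_suminf_le[OF _ sum_w[of x], of "\<lambda>k. \<psi> k x"] \<psi>_le by simp
    also have "\<dots> \<le> \<phi> \<bar>x\<bar>" by (intro suminf_le_const sum_w w_le) simp
    also have "\<dots> \<le> norm x * norm \<phi>" using norm_blinfun[of \<phi> "\<bar>x\<bar>"] by (simp add: mult.commute)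
    finally show ?thesis .
  qed
  ultimately obtain s :: "'a \<Rightarrow>\<^sub>L real" where s: "\<And>x. s x = L x"
    using blinfun_of_linear by blast
  show ?thesis
  proof (intro exI[of _ s] conjI allI)
    show sums: "(\<lambda>k. \<psi> k x) sums s x" for x
      using summable by (simp add: s L_def summable_sums)
    fix k
    have "\<bar>blinfun_apply (s - \<psi> k) x\<bar> \<le> blinfun_apply (\<phi> - w k) x" if x: "0 \<le> x" for x
    proof (rule LIMSEQ_le_const2)
      show "(\<lambda>n. \<bar>(\<Sum>j<n + Suc k. \<psi> j x) - \<psi> k x\<bar>) \<longlonglongrightarrow> \<bar>blinfun_apply (s - \<psi> k) x\<bar>"
        unfolding blinfun.diff_left
        using sums[of x] by (intro tendsto_intros LIMSEQ_ignore_initial_segment) (simp add: sums_def)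
      have "\<bar>(\<Sum>j<n + Suc k. \<psi> j x) - \<psi> k x\<bar> \<le> blinfun_apply (\<phi> - w k) x" for n
      proof -
        have "(\<Sum>j<n + Suc k. \<psi> j x) - \<psi> k x = (\<Sum>j\<in>{..<n + Suc k} - {k}. \<psi> j x)"
          by (subst sum.remove[of _ k]) auto
        also have "\<bar>\<dots>\<bar> \<le> (\<Sum>j\<in>{..<n + Suc k} - {k}. w j x)"
          using \<psi>_le[of _ x] x by (intro order_trans[OF sum_abs] sum_mono) (simp add: abs_of_nonneg)
        also have "\<dots> = (\<Sum>j<n + Suc k. w j x) - w k x"
          by (subst (2) sum.remove[of _ k]) auto
        also have "\<dots> \<le> \<phi> x - w k x" using w_le[OF x, of "n + Suc k"] by simp
        finally show ?thesis by (simp add: blinfun.diff_left)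
      qed
      thus "\<exists>N. \<forall>n\<ge>N. \<bar>(\<Sum>j<n + Suc k. \<psi> j x) - \<psi> k x\<bar> \<le> blinfun_apply (\<phi> - w k) x" by blast
    qed
    thus "\<bar>s - \<psi> k\<bar> \<le> \<phi> - w k"
      by (rule abs_blinfun_leI)
  qed
qed

section \<open>Moduli of disjoint weak-star null sequences\<close>

text \<open>If the \<open>u k\<close> are regarded as subsets of \<open>\<phi>\<close>, then \<open>w k\<close> is \<open>u k\<close> without the preceding sets. The
increments of the running suprema play this part in any vector lattice. They need not be disjoint,
but their sums stay below \<open>\<phi>\<close>.\<close>

lemma telescoping_suprema:
  fixes u :: "nat \<Rightarrow> 'a::lattice_ab_group_add"
  assumes "0 \<le> \<phi>" "\<And>k. 0 \<le> u k" "\<And>k. u k \<le> \<phi>"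
  obtains w where "\<And>k. 0 \<le> w k" "\<And>n. (\<Sum>k<n. w k) \<le> \<phi>"
    "\<And>k. u k - w k \<le> (\<Sum>i<k. u i)"
proof -
  define V where "V = rec_nat 0 (\<lambda>k v. sup v (u k))"
  have V: "V 0 = 0" "V (Suc k) = sup (V k) (u k)" for k by (simp_all add: V_def)
  have V_le: "V n \<le> \<phi>" for n using assms by (induction n) (auto simp: V)
  have V_nonneg: "0 \<le> V n" for n by (induction n) (auto simp: V intro: le_supI1)
  have V_sum: "V n \<le> (\<Sum>i<n. u i)" for n
  proof (induction n)
    case (Suc n)
    have "V (Suc n) \<le> V n + u n"
      using assms(2)[of n] V_nonneg[of n] by (simp add: V)
    also have "\<dots> \<le> (\<Sum>i<n. u i) + u n" using Suc by simp
    finally show ?case by simp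
  qed (simp add: V)
  show thesis
  proof
    show "0 \<le> V (Suc k) - V k" for k by (simp add: V)
    have "(\<Sum>k<n. V (Suc k) - V k) = V n" for n
      using sum_lessThan_telescope[of V n] V by simp
    thus "(\<Sum>k<n. V (Suc k) - V k) \<le> \<phi>" for n using V_le by simp
    fix k
    have "u k \<le> V (Suc k)" by (simp add: V)
    hence "u k - (V (Suc k) - V k) \<le> V k" by (simp add: diff_le_eq)
    also note V_sum[of k]
    finally show "u k - (V (Suc k) - V k) \<le> (\<Sum>i<k. u i)" .
  qed
qed

lemma telescoping_suprema_apply:
  fixes H :: "'a::banach_lattice \<Rightarrow>\<^sub>L real"
  assumes "0 \<le> H" "u k - w k \<le> (\<Sum>i<k. u i)"
  shows "H (\<phi> - w k) \<le> H (\<phi> - u k) + (\<Sum>i<k. H (u i))"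
proof -
  have "H (u k - w k) \<le> H (\<Sum>i<k. u i)" by (rule blinfun_mono[OF assms])
  thus ?thesis by (simp add: blinfun.diff_right blinfun.sum_right)
qed

text \<open>The first \<open>N\<close> functionals indexed by \<open>M\<close> can be concentrated, up to \<open>\<delta>\<close>, on pieces \<open>w k\<close> of \<open>\<phi>\<close>
with sum at most \<open>\<phi>\<close>. If \<open>N > 1 / \<delta>\<close>, each functional of the whole sequence is at most \<open>\<delta>\<close> on one of
these pieces, and by the pigeonhole principle one piece serves infinitely many indices.\<close>

lemma concentrate_on_infinite_subset:
  fixes H :: "nat \<Rightarrow> 'a::banach_lattice \<Rightarrow>\<^sub>L real"
  assumes H: "\<And>n. 0 \<le> H n" "\<And>m n. m \<noteq> n \<Longrightarrow> inf (H m) (H n) = 0"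
    and \<phi>: "0 \<le> \<phi>" "\<And>n. H n \<phi> \<le> 1"
    and M: "infinite M" and \<delta>: "0 < \<delta>"
  shows "\<exists>n v M'. n \<in> M \<and> M' \<subseteq> M \<and> infinite M' \<and> 0 \<le> v \<and> v \<le> \<phi> \<and> H n (\<phi> - v) \<le> \<delta> \<and>
    (\<forall>m\<in>M'. n < m \<and> H m v \<le> \<delta>)"
proof -
  obtain N where N: "1 / \<delta> < real N" using reals_Archimedean2 by blast
  hence N0: "0 < real N" using \<delta> by (meson divide_pos_pos less_trans zero_less_one)
  \<comment> \<open>Telescoping accumulates at most \<open>N\<close> errors of size \<open>\<eta>\<close>.\<close>
  define \<eta> where "\<eta> = \<delta> / (real N + 1)"
  have \<eta>: "0 < \<eta>" using \<delta> by (simp add: \<eta>_def)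
  define e where "e = enumerate M"
  have e: "strict_mono e" "\<And>i. e i \<in> M"
    using M by (simp_all add: e_def strict_mono_enumerate enumerate_in_set)
  \<comment> \<open>\<open>u i\<close> carries the \<open>i\<close>-th functional and is small for the later ones, as telescoping requires.\<close>
  have "\<exists>u. 0 \<le> u \<and> u \<le> \<phi> \<and> H (e i) (\<phi> - u) + (\<Sum>j\<in>{i<..<N}. H (e j)) u < \<eta>" for i
  proof (rule disjoint_apply_approx[OF _ \<phi>(1) \<eta>])
    show "inf (H (e i)) (\<Sum>j\<in>{i<..<N}. H (e j)) = 0"
      using H strict_mono_eq[OF e(1)] by (intro disjoint_sum) auto
  qed
  then obtain u where u: "\<And>i. 0 \<le> u i" "\<And>i. u i \<le> \<phi>"
    "\<And>i. H (e i) (\<phi> - u i) + (\<Sum>j\<in>{i<..<N}. H (e j)) (u i) < \<eta>" by metis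
  have nn: "0 \<le> H n (\<phi> - u i)" "0 \<le> H n (u i)" for n i
    using u by (auto intro!: blinfun_nonneg H)
  have u1: "H (e i) (\<phi> - u i) \<le> \<eta>" for i
  proof -
    have "0 \<le> (\<Sum>j\<in>{i<..<N}. H (e j)) (u i)"
      using nn by (auto simp: blinfun.sum_left intro: sum_nonneg)
    thus ?thesis using u(3)[of i] by linarith
  qed
  have u2: "H (e j) (u i) \<le> \<eta>" if "i < j" "j < N" for i j
  proof -
    have "H (e j) (u i) \<le> (\<Sum>j\<in>{i<..<N}. H (e j) (u i))"
      using that nn by (intro member_le_sum) auto
    thus ?thesis using u(3)[of i] nn(1)[of "e i" i] by (simp add: blinfun.sum_left)
  qed
  obtain w where w: "\<And>k. 0 \<le> w k" "\<And>n. (\<Sum>k<n. w k) \<le> \<phi>" "\<And>k. u k - w k \<le> (\<Sum>i<k. u i)"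
    using telescoping_suprema[of \<phi> u] \<phi>(1) u(1,2) by blast
  have w1: "H (e k) (\<phi> - w k) \<le> \<delta>" if k: "k < N" for k
  proof -
    have "H (e k) (\<phi> - w k) \<le> H (e k) (\<phi> - u k) + (\<Sum>i<k. H (e k) (u i))"
      by (rule telescoping_suprema_apply[OF H(1) w(3)])
    also have "\<dots> \<le> \<eta> + (\<Sum>i<k. \<eta>)"
      using k by (intro add_mono u1 sum_mono u2) auto
    also have "\<dots> = (real k + 1) * \<eta>" by (simp add: algebra_simps)
    also have "\<dots> \<le> (real N + 1) * \<eta>" using k \<eta> by (intro mult_right_mono) auto
    also have "\<dots> = \<delta>" using N0 by (simp add: \<eta>_def)
    finally show ?thesis .
  qed
  have "\<exists>k<N. H m (w k) \<le> \<delta>" for m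
  proof (rule ccontr)
    assume "\<not> ?thesis"
    hence "(\<Sum>k<N. \<delta>) \<le> (\<Sum>k<N. H m (w k))" by (intro sum_mono) auto
    also have "\<dots> \<le> H m \<phi>"
      using blinfun_mono[OF H(1) w(2), of m N] by (simp add: blinfun.sum_right)
    also have "\<dots> \<le> 1" by (rule \<phi>(2))
    finally show False using N \<delta> by (simp add: field_simps)
  qed
  hence "M \<subseteq> (\<Union>k<N. {m \<in> M. H m (w k) \<le> \<delta>})" by blast
  hence "\<exists>k<N. infinite {m \<in> M. H m (w k) \<le> \<delta>}"
    using M by (meson finite_UN_I finite_lessThan finite_subset lessThan_iff)
  then obtain k where k: "k < N" "infinite {m \<in> M. H m (w k) \<le> \<delta>}" by blast
  define M' where "M' = {m \<in> M. H m (w k) \<le> \<delta>} - {..e k}"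
  have "infinite M'" unfolding M'_def using k(2) by (intro Diff_infinite_finite) auto
  moreover have "w k \<le> \<phi>"
    using sum_mono2[of "{..<Suc k}" "{k}" w] w(1) by (intro order_trans[OF _ w(2)[of "Suc k"]]) simp
  ultimately show ?thesis using e(2)[of k] w(1)[of k] w1[OF k(1)]
    by (intro exI[of _ "e k"] exI[of _ "w k"] exI[of _ M']) (auto simp: M'_def)
qed

text \<open>Iterating the preceding lemma along a decreasing sequence of infinite index sets gives \<open>v k\<close> that
carry the functional \<open>H (r k)\<close> up to \<open>d k\<close> and on which all later functionals are at most \<open>d k\<close>.
Telescoping then discards from \<open>v k\<close> only what earlier \<open>v i\<close> cover, and \<open>H (r k)\<close> is small there.\<close>

theorem concentrate_disjoint_functionals:
  fixes H :: "nat \<Rightarrow> 'a::banach_lattice \<Rightarrow>\<^sub>L real"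
  assumes H: "\<And>n. 0 \<le> H n" "\<And>m n. m \<noteq> n \<Longrightarrow> inf (H m) (H n) = 0"
    and \<phi>: "0 \<le> \<phi>" "\<And>n. H n \<phi> \<le> 1" and \<delta>: "0 < \<delta>"
  obtains r w where "strict_mono (r :: nat \<Rightarrow> nat)" "\<And>k. 0 \<le> w k" "\<And>n. (\<Sum>k<n. w k) \<le> \<phi>"
    "\<And>k. H (r k) (\<phi> - w k) \<le> \<delta>"
proof -
  define d where "d k = \<delta> * (1 / 2) ^ Suc k" for k
  have d: "0 < d k" for k using \<delta> by (simp add: d_def)
  define P where "P = (\<lambda>k (n, v, M). infinite M \<and> 0 \<le> v \<and> v \<le> \<phi> \<and> H n (\<phi> - v) \<le> d k \<and>
    (\<forall>m\<in>M. n < m \<and> H m v \<le> d k))"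
  define Q where "Q = (\<lambda>(k::nat) (n::nat, v::'a, M::nat set) (n'::nat, v'::'a, M'). n' \<in> M \<and> M' \<subseteq> M)"
  \<comment> \<open>A state consists of the index just chosen, its carrier, and the indices still available.\<close>
  have "\<exists>f. \<forall>k. P k (f k) \<and> Q k (f k) (f (Suc k))"
  proof (rule dependent_nat_choice)
    have one: "\<exists>n v M'. n \<in> M \<and> M' \<subseteq> M \<and> P k (n, v, M')" if M: "infinite M" for k M
    proof -
      obtain n v M' where "n \<in> M" "M' \<subseteq> M" "infinite M'" "0 \<le> v" "v \<le> \<phi>" "H n (\<phi> - v) \<le> d k"
        "\<forall>m\<in>M'. n < m \<and> H m v \<le> d k"
        using concentrate_on_infinite_subset[of H, OF H \<phi> M d[of k]] by blast
      thus ?thesis by (intro exI[of _ n] exI[of _ v] exI[of _ M']) (simp add: P_def)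
    qed
    show "\<exists>s. P 0 s" using one[of UNIV 0] by blast
    fix s k assume "P k s"
    then obtain n v M where s: "s = (n, v, M)" "infinite M" by (cases s) (simp add: P_def)
    from one[OF s(2), of "Suc k"] obtain n' v' M' where "n' \<in> M" "M' \<subseteq> M" "P (Suc k) (n', v', M')"
      by blast
    thus "\<exists>t. P (Suc k) t \<and> Q k s t"
      by (intro exI[of _ "(n', v', M')"]) (simp add: Q_def s)
  qed
  then obtain f where f: "\<And>k. P k (f k)" "\<And>k. Q k (f k) (f (Suc k))" by blast
  define r where "r k = fst (f k)" for k
  define v where "v k = fst (snd (f k))" for k
  define M where "M k = snd (snd (f k))" for k
  have f_eq: "f k = (r k, v k, M k)" for k by (simp add: r_def v_def M_def)
  have v: "0 \<le> v k" "v k \<le> \<phi>" "H (r k) (\<phi> - v k) \<le> d k"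
    and Mv: "\<And>m. m \<in> M k \<Longrightarrow> r k < m \<and> H m (v k) \<le> d k" for k
    using f(1)[of k] by (auto simp: P_def f_eq)
  have step: "r (Suc k) \<in> M k" "M (Suc k) \<subseteq> M k" for k
    using f(2)[of k] by (auto simp: Q_def f_eq)
  have "strict_mono r" using step(1) Mv by (intro strict_monoI_Suc) blast
  have rM: "r k \<in> M i" if "i < k" for i k
  proof -
    from that have "i \<le> k - 1" "k = Suc (k - 1)" by simp_all
    with lift_Suc_antimono_le[of M, OF step(2)] step(1)[of "k - 1"] show ?thesis by (metis subsetD)
  qed
  obtain w where w: "\<And>k. 0 \<le> w k" "\<And>n. (\<Sum>k<n. w k) \<le> \<phi>" "\<And>k. v k - w k \<le> (\<Sum>i<k. v i)"
    using telescoping_suprema[of \<phi> v] \<phi>(1) v(1,2) by blast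
  have sum_d: "(\<Sum>i<Suc k. d i) \<le> \<delta>" for k
  proof -
    have "(\<Sum>i<n. d i) = \<delta> * (1 - (1 / 2) ^ n)" for n
      by (induction n) (simp_all add: d_def algebra_simps)
    thus ?thesis using \<delta> by (simp only:) (intro mult_left_le, simp_all)
  qed
  have "H (r k) (\<phi> - w k) \<le> \<delta>" for k
  proof -
    have "H (r k) (\<phi> - w k) \<le> H (r k) (\<phi> - v k) + (\<Sum>i<k. H (r k) (v i))"
      by (rule telescoping_suprema_apply[OF H(1) w(3)])
    also have "\<dots> \<le> d k + (\<Sum>i<k. d i)"
      using Mv rM by (intro add_mono v sum_mono) auto
    also have "\<dots> \<le> \<delta>" using sum_d[of k] by simp
    finally show ?thesis .
  qed
  thus thesis using that \<open>strict_mono r\<close> w by blast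
qed

text \<open>A gliding hump: with \<open>w\<close> from the concentration theorem, choose \<open>\<psi> k\<close> of modulus at most \<open>w k\<close>
almost attaining the modulus of \<open>F (r k)\<close>. The sum \<open>s\<close> of all \<open>\<psi> k\<close> exists by Dedekind completeness, and
\<open>s - \<psi> k\<close> is dominated by \<open>\<phi> - w k\<close>, where \<open>F (r k)\<close> is negligible. So all \<open>F (r k)\<close> are bounded away
from 0 at the single element \<open>s\<close>.\<close>

lemma disjoint_weak_star_null_not_bounded_below:
  fixes F :: "nat \<Rightarrow> ('a::banach_lattice \<Rightarrow>\<^sub>L real) \<Rightarrow>\<^sub>L real"
  assumes disj: "disjoint_seq F" and null: "weak_star_null F"
    and \<phi>: "0 \<le> \<phi>" and bd: "\<And>n. blinfun_apply \<bar>F n\<bar> \<phi> \<le> 1"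
    and e: "0 < e" "\<And>n. e \<le> blinfun_apply \<bar>F n\<bar> \<phi>"
  shows False
proof -
  obtain r :: "nat \<Rightarrow> nat" and w where r: "strict_mono r" and w: "\<And>k. 0 \<le> w k"
    "\<And>n. (\<Sum>k<n. w k) \<le> \<phi>" "\<And>k. blinfun_apply \<bar>F (r k)\<bar> (\<phi> - w k) \<le> e / 4"
  proof (rule concentrate_disjoint_functionals[of "\<lambda>n. \<bar>F n\<bar>" \<phi> "e / 4"])
    show "inf \<bar>F m\<bar> \<bar>F n\<bar> = 0" if "m \<noteq> n" for m n
      using disj that by (simp add: disjoint_seq_def)
  qed (use \<phi> bd e(1) in auto)
  have "\<exists>v. \<bar>v\<bar> \<le> w k \<and> blinfun_apply \<bar>F (r k)\<bar> (w k) < F (r k) v + e / 4" for k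
    using w(1) e(1) by (intro abs_apply_approx) auto
  then obtain \<psi> where \<psi>: "\<And>k. \<bar>\<psi> k\<bar> \<le> w k"
    "\<And>k. blinfun_apply \<bar>F (r k)\<bar> (w k) < F (r k) (\<psi> k) + e / 4" by metis
  obtain s where s: "\<And>k. \<bar>s - \<psi> k\<bar> \<le> \<phi> - w k"
    using dual_order_series[of \<psi> w, OF \<psi>(1) w(2)] by auto
  have "e / 4 \<le> F (r k) s" for k
  proof -
    have "\<bar>F (r k) (s - \<psi> k)\<bar> \<le> blinfun_apply \<bar>F (r k)\<bar> (\<phi> - w k)"
      by (rule abs_blinfun_apply_le[OF s])
    hence "F (r k) (\<psi> k) - e / 4 \<le> F (r k) s"
      using w(3)[of k] by (simp add: blinfun.diff_right)
    moreover have "blinfun_apply \<bar>F (r k)\<bar> (w k) \<ge> e - e / 4"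
      using w(3)[of k] e(2)[of "r k"] by (simp add: blinfun.diff_right)
    ultimately show ?thesis using \<psi>(2)[of k] by linarith
  qed
  moreover have "(\<lambda>k. F (r k) s) \<longlonglongrightarrow> 0"
    using null r LIMSEQ_subseq_LIMSEQ unfolding weak_star_null_iff o_def by blast
  ultimately have "e / 4 \<le> 0" by (intro LIMSEQ_le_const) auto
  thus False using e(1) by simp
qed

text \<open>The hypothesis that the values at \<open>\<phi>\<close> are at most 1 in the preceding lemma is met by rescaling: the
factors \<open>c k \<le> 1\<close> preserve disjointness and weak-star nullity, and they leave the moduli bounded away
from 0 at \<open>\<phi>\<close>.\<close>

theorem abs_weak_star_null:
  fixes F :: "nat \<Rightarrow> ('a::banach_lattice \<Rightarrow>\<^sub>L real) \<Rightarrow>\<^sub>L real"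
  assumes disj: "disjoint_seq F" and null: "weak_star_null F"
  shows "weak_star_null (\<lambda>n. \<bar>F n\<bar>)"
proof -
  have lim: "(\<lambda>n. blinfun_apply \<bar>F n\<bar> \<phi>) \<longlonglongrightarrow> 0" if \<phi>: "0 \<le> \<phi>" for \<phi>
  proof (rule ccontr)
    assume "\<not> ?thesis"
    moreover have nn: "0 \<le> blinfun_apply \<bar>F n\<bar> \<phi>" for n using \<phi> by (simp add: blinfun_nonneg)
    ultimately obtain e0 where e0: "0 < e0" "\<exists>\<^sub>\<infinity>n. e0 \<le> blinfun_apply \<bar>F n\<bar> \<phi>"
      by (auto simp: LIMSEQ_def INFM_nat_le not_less)
    \<comment> \<open>Dividing a number that is at least \<open>e0\<close> by its maximum with 1 leaves at least \<open>min 1 e0\<close>.\<close>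
    define e where "e = min 1 e0"
    define q where "q = enumerate {n. e0 \<le> blinfun_apply \<bar>F n\<bar> \<phi>}"
    have inf: "infinite {n. e0 \<le> blinfun_apply \<bar>F n\<bar> \<phi>}"
      using e0(2) by (simp add: INFM_iff_infinite)
    hence q: "strict_mono q" "\<And>k. e0 \<le> blinfun_apply \<bar>F (q k)\<bar> \<phi>"
      using enumerate_in_set[OF inf] by (auto simp: q_def strict_mono_enumerate)
    define c where "c k = 1 / max 1 (blinfun_apply \<bar>F (q k)\<bar> \<phi>)" for k
    have c: "0 < c k" "c k \<le> 1" for k by (auto simp: c_def max_def)
    define G where "G k = c k *\<^sub>R F (q k)" for k
    have absG: "\<bar>G k\<bar> = c k *\<^sub>R \<bar>F (q k)\<bar>" for k by (simp add: G_def abs_scaleR_pos c)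
    show False
    proof (rule disjoint_weak_star_null_not_bounded_below)
      show "disjoint_seq G" unfolding disjoint_seq_def absG
        using disj strict_mono_eq[OF q(1)] c
        by (auto simp: disjoint_seq_def less_imp_le intro!: disjoint_scaleR)
      show "weak_star_null G" unfolding weak_star_null_iff
      proof
        fix x
        have "(\<lambda>k. F (q k) x) \<longlonglongrightarrow> 0"
          using null q(1) LIMSEQ_subseq_LIMSEQ unfolding weak_star_null_iff o_def by blast
        thus "(\<lambda>k. G k x) \<longlonglongrightarrow> 0"
        proof (rule Lim_null_comparison[rotated, OF tendsto_rabs_zero])
          show "\<forall>\<^sub>F k in sequentially. norm (G k x) \<le> \<bar>F (q k) x\<bar>"
            using c by (auto simp: G_def blinfun.scaleR_left abs_mult mult_left_le_one_le less_imp_le)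
        qed
      qed
      show "0 \<le> \<phi>" by fact
      show "blinfun_apply \<bar>G n\<bar> \<phi> \<le> 1" for n
        by (simp add: absG blinfun.scaleR_left c_def max_def)
      show "0 < e" using e0 by (simp add: e_def)
      show "e \<le> blinfun_apply \<bar>G n\<bar> \<phi>" for n
        using q(2)[of n] by (auto simp: absG blinfun.scaleR_left c_def max_def e_def)
    qed
  qed
  show ?thesis unfolding weak_star_null_iff
  proof
    fix x :: "'a \<Rightarrow>\<^sub>L real"
    show "(\<lambda>n. blinfun_apply \<bar>F n\<bar> x) \<longlonglongrightarrow> 0"
    proof (rule Lim_null_comparison)
      show "\<forall>\<^sub>F n in sequentially. norm (blinfun_apply \<bar>F n\<bar> x) \<le> blinfun_apply \<bar>F n\<bar> \<bar>x\<bar>"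
        using abs_blinfun_apply_le[of x "\<bar>x\<bar>" "\<bar>F _\<bar>"] by simp
    qed (rule lim, simp)
  qed
qed

section \<open>Disjoint minorants\<close>

text \<open>The minorants are \<open>(p k - 4 ^ k * (\<Sum>i<k. p i) - (1 / 2) ^ k * x)\<^sup>+\<close> with \<open>p k = \<phi> (r k)\<close> and
\<open>x = \<Sum>i. (1 / 2) ^ i * p i\<close>. For \<open>m < k\<close> the \<open>k\<close>-th is below \<open>(p k - 4 ^ k * p m)\<^sup>+\<close>, while the
term in \<open>x\<close> bounds the \<open>m\<close>-th by a multiple of \<open>(4 ^ k * p m - p k)\<^sup>+\<close>, so they are disjoint.
Little is lost under \<open>H (r k)\<close>: as \<open>H\<close> is weak-star null, the subsequence can be chosen such that
\<open>H (r k)\<close> is tiny on the earlier \<open>p i\<close>, and its value at the fixed vector \<open>x\<close> tends to 0.\<close>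

theorem disjoint_minorants:
  fixes H :: "nat \<Rightarrow> 'a::banach_lattice \<Rightarrow>\<^sub>L real" and \<phi> :: "nat \<Rightarrow> 'a"
  assumes H: "\<And>n. 0 \<le> H n" "weak_star_null H"
    and \<phi>: "\<And>n. 0 \<le> \<phi> n" "\<And>n. norm (\<phi> n) \<le> C"
    and e: "0 < e" "\<And>n. e \<le> H n (\<phi> n)"
  obtains r w where "strict_mono (r :: nat \<Rightarrow> nat)" "\<And>k. 0 \<le> w k" "\<And>k. w k \<le> \<phi> (r k)"
    "\<And>m n. m \<noteq> n \<Longrightarrow> inf (w m) (w n) = 0" "\<forall>\<^sub>F k in sequentially. e / 2 \<le> H (r k) (w k)"
proof -
  have H0: "(\<lambda>n. H n x) \<longlonglongrightarrow> 0" for x using H(2) by (simp add: weak_star_null_iff)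
  \<comment> \<open>The bound compensates the factor \<open>4 ^ Suc k\<close> in the definition of \<open>w (Suc k)\<close> below.\<close>
  have "\<exists>r::nat \<Rightarrow> nat. \<forall>k. True \<and> (r k < r (Suc k) \<and>
      H (r (Suc k)) (\<Sum>i\<le>r k. \<phi> i) \<le> e / 4 / 4 ^ Suc k)"
  proof (rule dependent_nat_choice)
    fix m k :: nat
    have "\<forall>\<^sub>F n in sequentially. m < n \<and> H n (\<Sum>i\<le>m. \<phi> i) < e / 4 / 4 ^ Suc k"
      using e(1) by (intro eventually_conj eventually_gt_at_top order_tendstoD(2)[OF H0]) simp
    from eventually_happens[OF this]
    show "\<exists>n. True \<and> (m < n \<and> H n (\<Sum>i\<le>m. \<phi> i) \<le> e / 4 / 4 ^ Suc k)"
      by (auto intro: less_imp_le)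
  qed simp
  then obtain r :: "nat \<Rightarrow> nat" where r: "\<And>k. r k < r (Suc k)"
    "\<And>k. H (r (Suc k)) (\<Sum>i\<le>r k. \<phi> i) \<le> e / 4 / 4 ^ Suc k" by auto
  have mono: "strict_mono r" using r(1) by (rule strict_monoI_Suc)
  define p where "p k = \<phi> (r k)" for k
  have p0: "0 \<le> p k" for k using \<phi> by (simp add: p_def)
  have small: "4 ^ k * H (r k) (\<Sum>i<k. p i) \<le> e / 4" for k
  proof (cases k)
    case (Suc j)
    have "(\<Sum>i<k. p i) = (\<Sum>i\<in>r ` {..<k}. \<phi> i)"
      using strict_mono_imp_inj_on[OF mono] by (subst sum.reindex) (auto simp: p_def intro: inj_on_subset)
    also have "\<dots> \<le> (\<Sum>i\<le>r j. \<phi> i)"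
      using \<phi>(1) strict_mono_mono[OF mono] Suc by (intro sum_mono2) (auto simp: mono_def)
    finally have "H (r k) (\<Sum>i<k. p i) \<le> H (r k) (\<Sum>i\<le>r j. \<phi> i)" by (rule blinfun_mono[OF H(1)])
    also have "\<dots> \<le> e / 4 / 4 ^ k" using r(2)[of j] Suc by simp
    finally show ?thesis by (simp add: field_simps)
  qed (use e in simp)
  have summ: "summable (\<lambda>i. (1 / 2) ^ i *\<^sub>R p i)"
  proof (rule summable_comparison_test')
    show "summable (\<lambda>i. (1 / 2) ^ i * C)" by (intro summable_mult2 summable_geometric) simp
    show "norm ((1 / 2) ^ i *\<^sub>R p i) \<le> (1 / 2) ^ i * C" for i
      using \<phi>(2)[of "r i"] by (simp add: p_def)
  qed
  define x where "x = (\<Sum>i. (1 / 2) ^ i *\<^sub>R p i)"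
  have x: "(1 / 2) ^ i *\<^sub>R p i \<le> x" for i
    unfolding x_def using p0 by (intro le_suminf_nonneg[OF summ]) (simp add: scaleR_nonneg_nonneg)
  have x0: "0 \<le> x" using x[of 0] p0[of 0] by simp
  define w where "w k = pprt (p k - 4 ^ k *\<^sub>R (\<Sum>i<k. p i) - (1 / 2) ^ k *\<^sub>R x)" for k
  have S0: "0 \<le> 4 ^ k *\<^sub>R (\<Sum>i<k. p i)" for k
    by (intro scaleR_nonneg_nonneg sum_nonneg p0) simp
  have X0: "0 \<le> (1 / 2) ^ k *\<^sub>R x" for k :: nat
    by (intro scaleR_nonneg_nonneg x0) simp
  show thesis
  proof
    show "strict_mono r" by (rule mono)
    show "0 \<le> w k" for k by (simp add: w_def)
    show "w k \<le> \<phi> (r k)" for k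
    proof -
      have "p k - 4 ^ k *\<^sub>R (\<Sum>i<k. p i) - (1 / 2) ^ k *\<^sub>R x \<le> p k"
        using diff_left_mono[OF add_nonneg_nonneg[OF S0 X0], of "p k" k k]
        by (simp only: diff_diff_eq diff_0_right)
      thus ?thesis using p0[of k] unfolding w_def pprt_def p_def by (rule le_supI)
    qed
    have *: "inf (w k) (w m) = 0" if "m < k" for m k
    proof (rule order.antisym)
      have "p m \<le> (\<Sum>i<k. p i)" using sum_mono2[of "{..<k}" "{m}" p] p0 that by simp
      hence "4 ^ k *\<^sub>R p m \<le> 4 ^ k *\<^sub>R (\<Sum>i<k. p i)" by (intro scaleR_left_mono) simp_all
      also have "\<dots> \<le> 4 ^ k *\<^sub>R (\<Sum>i<k. p i) + (1 / 2) ^ k *\<^sub>R x" using X0 by simp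
      finally have 1: "w k \<le> pprt (p k - 4 ^ k *\<^sub>R p m)"
        unfolding w_def by (intro pprt_mono) (simp add: diff_diff_eq diff_left_mono)
      have "(1 / 4 :: real) ^ k = (1 / 2) ^ k * (1 / 2) ^ k" by (simp add: power_mult_distrib[symmetric])
      also have "\<dots> \<le> (1 / 2) ^ m * (1 / 2) ^ k"
        using that by (intro mult_right_mono power_decreasing) auto
      finally have "(1 / 4) ^ k *\<^sub>R p k \<le> ((1 / 2) ^ m * (1 / 2) ^ k) *\<^sub>R p k"
        using p0 by (rule scaleR_right_mono)
      also have "\<dots> \<le> (1 / 2) ^ m *\<^sub>R x"
        using scaleR_left_mono[OF x[of k], of "(1 / 2) ^ m"] by simp
      also have "\<dots> \<le> 4 ^ m *\<^sub>R (\<Sum>i<m. p i) + (1 / 2) ^ m *\<^sub>R x" using S0 by simp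
      finally have "w m \<le> pprt (p m - (1 / 4) ^ k *\<^sub>R p k)"
        unfolding w_def by (intro pprt_mono) (simp add: diff_diff_eq diff_left_mono)
      also have "p m - (1 / 4) ^ k *\<^sub>R p k = (1 / 4) ^ k *\<^sub>R (4 ^ k *\<^sub>R p m - p k)"
        by (simp add: scaleR_diff_right power_mult_distrib[symmetric])
      also have "pprt \<dots> = (1 / 4) ^ k *\<^sub>R pprt (4 ^ k *\<^sub>R p m - p k)"
        by (intro pprt_scaleR) simp
      finally have "inf (w k) (w m) \<le> inf (1 *\<^sub>R pprt (p k - 4 ^ k *\<^sub>R p m)) ((1 / 4) ^ k *\<^sub>R pprt (4 ^ k *\<^sub>R p m - p k))"
        using 1 by (simp only: scaleR_one) (rule inf_mono)
      also have "\<dots> = 0" by (intro disjoint_scaleR pprt_diff_eq_0) simp_all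
      finally show "inf (w k) (w m) \<le> 0" .
      show "0 \<le> inf (w k) (w m)" by (simp add: w_def)
    qed
    show "inf (w m) (w n) = 0" if "m \<noteq> n" for m n
      using *[of m n] *[of n m] that by (cases m n rule: linorder_cases) (auto simp: inf_commute)
    have "(\<lambda>k. H (r k) x) \<longlonglongrightarrow> 0"
      using LIMSEQ_subseq_LIMSEQ[OF H0 mono] by (simp add: o_def)
    hence "\<forall>\<^sub>F k in sequentially. H (r k) x < e / 4"
      using e(1) by (intro order_tendstoD(2)) auto
    thus "\<forall>\<^sub>F k in sequentially. e / 2 \<le> H (r k) (w k)"
    proof eventually_elim
      case (elim k)
      have "(1 / 2) ^ k * H (r k) x \<le> H (r k) x"
        using blinfun_nonneg[OF H(1) x0] by (intro mult_left_le_one_le power_le_one) auto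
      hence "e / 2 \<le> H (r k) (p k) - 4 ^ k * H (r k) (\<Sum>i<k. p i) - (1 / 2) ^ k * H (r k) x"
        using elim small[of k] e(2)[of "r k"] unfolding p_def by linarith
      also have "\<dots> = H (r k) (p k - 4 ^ k *\<^sub>R (\<Sum>i<k. p i) - (1 / 2) ^ k *\<^sub>R x)"
        by (simp add: blinfun.diff_right blinfun.scaleR_right)
      also have "\<dots> \<le> H (r k) (w k)"
        unfolding w_def pprt_def by (intro blinfun_mono H(1)) simp
      finally show ?case .
    qed
  qed
qed

section \<open>Components of a positive functional\<close>

text \<open>\<open>L\<close> is obtained as a functional below the component of \<open>G\<close> in the ideal generated by \<open>w\<close>, which is
\<open>\<phi> \<mapsto> sup {G u | 0 \<le> u \<le> \<phi>, u \<le> t w for some t}\<close> on positive \<open>\<phi>\<close>. With \<open>\<phi>\<close> replaced by its positive part,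
the formula is sublinear on the whole space, so that Hahn-Banach replaces a proof of additivity.
The last clause states that \<open>L\<close> lies below this supremum.\<close>

lemma component_functional:
  fixes G :: "'a::banach_lattice \<Rightarrow>\<^sub>L real"
  assumes G: "0 \<le> G" and w: "0 \<le> w"
  obtains L :: "'a \<Rightarrow>\<^sub>L real" where "0 \<le> L" "L w = G w"
    "\<And>\<phi> e. 0 \<le> \<phi> \<Longrightarrow> 0 < e \<Longrightarrow>
       \<exists>u t. 0 \<le> u \<and> u \<le> \<phi> \<and> 0 \<le> t \<and> u \<le> t *\<^sub>R w \<and> L \<phi> < G u + e"
proof -
  define U where "U \<phi> = {u. 0 \<le> u \<and> u \<le> pprt \<phi> \<and> (\<exists>t\<ge>0. u \<le> t *\<^sub>R w)}" for \<phi>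
  define p where "p \<phi> = (SUP u\<in>U \<phi>. G u)" for \<phi>
  have U0: "0 \<in> U \<phi>" for \<phi> using w by (auto simp: U_def intro: exI[of _ 0])
  have bdd: "bdd_above (blinfun_apply G ` U \<phi>)" for \<phi>
    by (rule bdd_aboveI2[where M = "G (pprt \<phi>)"]) (auto simp: U_def intro: blinfun_mono[OF G])
  have ge: "G u \<le> p \<phi>" if "u \<in> U \<phi>" for u \<phi>
    unfolding p_def using bdd that by (intro cSUP_upper) auto
  have le: "p \<phi> \<le> c" if "\<And>u. u \<in> U \<phi> \<Longrightarrow> G u \<le> c" for \<phi> c
    unfolding p_def using U0 that by (intro cSUP_least) auto
  have scale: "p (s *\<^sub>R \<phi>) \<le> s * p \<phi>" if s: "0 < s" for s \<phi>
  proof (rule le)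
    fix u assume "u \<in> U (s *\<^sub>R \<phi>)"
    then obtain t where u: "0 \<le> u" "u \<le> s *\<^sub>R pprt \<phi>" "0 \<le> t" "u \<le> t *\<^sub>R w"
      using s by (auto simp: U_def pprt_scaleR)
    have "inverse s *\<^sub>R u \<le> inverse s *\<^sub>R (s *\<^sub>R pprt \<phi>)"
      using u s by (intro scaleR_left_mono) auto
    moreover have "inverse s *\<^sub>R u \<le> inverse s *\<^sub>R (t *\<^sub>R w)"
      using u s by (intro scaleR_left_mono) auto
    ultimately have "inverse s *\<^sub>R u \<in> U \<phi>" unfolding U_def using s u
      by (auto simp: scaleR_nonneg_nonneg intro!: exI[of _ "inverse s * t"])
    from ge[OF this] show "G u \<le> s * p \<phi>" using s by (simp add: blinfun.scaleR_right field_simps)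
  qed
  have sub: "sublinear p" unfolding sublinear_def
  proof (intro conjI allI impI)
    fix \<phi> \<psi>
    show "p (\<phi> + \<psi>) \<le> p \<phi> + p \<psi>"
    proof (rule le)
      fix u assume "u \<in> U (\<phi> + \<psi>)"
      then obtain t where u: "0 \<le> u" "u \<le> pprt (\<phi> + \<psi>)" "0 \<le> t" "u \<le> t *\<^sub>R w" by (auto simp: U_def)
      have "u \<le> pprt \<phi> + pprt \<psi>" using u(2) pprt_add_le by (rule order_trans)
      from riesz_decomposition[OF u(1) this zero_le_pprt zero_le_pprt]
      obtain a b where ab: "0 \<le> a" "a \<le> pprt \<phi>" "0 \<le> b" "b \<le> pprt \<psi>" "u = a + b" by blast
      have "a \<le> u" "b \<le> u" using ab by simp_all
      hence "a \<le> t *\<^sub>R w" "b \<le> t *\<^sub>R w" using u(4) by (auto intro: order_trans)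
      hence "a \<in> U \<phi>" "b \<in> U \<psi>" unfolding U_def using ab u(3) by blast+
      from ge[OF this(1)] ge[OF this(2)] show "G u \<le> p \<phi> + p \<psi>"
        by (simp add: ab(5) blinfun.add_right)
    qed
  next
    fix s :: real and \<phi> assume s: "0 < s"
    have "p (inverse s *\<^sub>R (s *\<^sub>R \<phi>)) \<le> inverse s * p (s *\<^sub>R \<phi>)" using s by (intro scale) simp
    hence "s * p \<phi> \<le> p (s *\<^sub>R \<phi>)" using s by (simp add: field_simps)
    with scale[OF s] show "p (s *\<^sub>R \<phi>) = s * p \<phi>" by (rule order.antisym)
  qed
  from hahn_banach_sublinear[OF this, of w] obtain L where
    L: "linear L" "\<And>\<phi>. L \<phi> \<le> p \<phi>" "L w = p w" by blast
  have p_le: "p \<phi> \<le> G (pprt \<phi>)" for \<phi>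
    by (rule le) (auto simp: U_def intro: blinfun_mono[OF G])
  have "\<bar>L \<phi>\<bar> \<le> norm \<phi> * norm G" for \<phi>
  proof -
    have *: "L \<psi> \<le> norm \<psi> * norm G" for \<psi>
    proof -
      have "L \<psi> \<le> G (pprt \<psi>)" using L(2) p_le by (rule order_trans)
      also have "\<dots> \<le> norm G * norm (pprt \<psi>)" using norm_blinfun[of G "pprt \<psi>"] by simp
      also have "\<dots> \<le> norm G * norm \<psi>" by (intro mult_left_mono norm_pprt_le) simp
      finally show ?thesis by (simp add: mult.commute)
    qed
    from *[of \<phi>] *[of "- \<phi>"] show ?thesis using linear_neg[OF L(1), of \<phi>] by simp
  qed
  from blinfun_of_linear[OF L(1) this] obtain L' :: "'a \<Rightarrow>\<^sub>L real" where L': "\<And>\<phi>. L' \<phi> = L \<phi>" by blast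
  show thesis
  proof
    show "0 \<le> L'" unfolding less_eq_blinfun_def
    proof (intro allI impI)
      fix \<phi> :: 'a assume "0 \<le> \<phi>"
      hence "p (- \<phi>) \<le> 0" using p_le[of "- \<phi>"] by simp
      thus "blinfun_apply 0 \<phi> \<le> L' \<phi>"
        using L(2)[of "- \<phi>"] linear_neg[OF L(1), of \<phi>] by (simp add: L')
    qed
    have "w \<in> U w" using w by (auto simp: U_def intro!: exI[of _ 1])
    from ge[OF this] p_le[of w] show "L' w = G w" using w by (simp add: L' L)
    fix \<phi> :: 'a and e :: real assume \<phi>: "0 \<le> \<phi>" and e: "0 < e"
    have "L' \<phi> - e < p \<phi>" using L(2)[of \<phi>] e by (simp add: L')
    then obtain u where u: "u \<in> U \<phi>" "L' \<phi> - e < G u"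
      unfolding p_def using less_cSUP_iff[OF _ bdd, of \<phi>] U0 by blast
    then obtain t where "0 \<le> u" "u \<le> \<phi>" "0 \<le> t" "u \<le> t *\<^sub>R w" using \<phi> by (auto simp: U_def)
    thus "\<exists>u t. 0 \<le> u \<and> u \<le> \<phi> \<and> 0 \<le> t \<and> u \<le> t *\<^sub>R w \<and> L' \<phi> < G u + e"
      using u(2) by (intro exI[of _ u] exI[of _ t]) simp
  qed
qed

text \<open>Elements \<open>u k\<close> of the ideals generated by disjoint \<open>w k\<close> are disjoint. If they all lie below \<open>\<phi>\<close>, so
does their sum, and therefore the components of \<open>G\<close> add up to at most \<open>G\<close>.\<close>

lemma disjoint_components:
  fixes G :: "'a::banach_lattice \<Rightarrow>\<^sub>L real" and w :: "nat \<Rightarrow> 'a"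
  assumes G: "0 \<le> G" and w: "\<And>k. 0 \<le> w k" "\<And>m n. m \<noteq> n \<Longrightarrow> inf (w m) (w n) = 0"
  shows "\<exists>L :: nat \<Rightarrow> 'a \<Rightarrow>\<^sub>L real. (\<forall>k. 0 \<le> L k) \<and> (\<forall>k. blinfun_apply (L k) (w k) = G (w k)) \<and>
    (\<forall>n. (\<Sum>k<n. L k) \<le> G)"
proof -
  have "\<exists>L :: 'a \<Rightarrow>\<^sub>L real. 0 \<le> L \<and> blinfun_apply L (w k) = G (w k) \<and> (\<forall>\<phi> e. 0 \<le> \<phi> \<longrightarrow> 0 < e \<longrightarrow>
       (\<exists>u t. 0 \<le> u \<and> u \<le> \<phi> \<and> 0 \<le> t \<and> u \<le> t *\<^sub>R w k \<and> blinfun_apply L \<phi> < G u + e))" for k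
    using component_functional[OF G w(1)[of k]] by metis
  then obtain L :: "nat \<Rightarrow> 'a \<Rightarrow>\<^sub>L real" where L: "\<And>k. 0 \<le> L k" "\<And>k. L k (w k) = G (w k)"
    "\<And>k \<phi> e. 0 \<le> \<phi> \<Longrightarrow> 0 < e \<Longrightarrow> \<exists>u t. 0 \<le> u \<and> u \<le> \<phi> \<and> 0 \<le> t \<and> u \<le> t *\<^sub>R w k \<and> L k \<phi> < G u + e"
    by metis
  have "(\<Sum>k<n. L k) \<le> G" for n
    unfolding less_eq_blinfun_def
  proof (intro allI impI)
    fix \<phi> :: 'a assume \<phi>: "0 \<le> \<phi>"
    have "(\<Sum>k<n. L k \<phi>) \<le> G \<phi> + e" if e: "0 < e" for e
    proof -
      define \<eta> where "\<eta> = e / (real n + 1)"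
      have \<eta>: "0 < \<eta>" using e by (simp add: \<eta>_def)
      from L(3)[OF \<phi> \<eta>] obtain u t where u: "\<And>k. 0 \<le> u k" "\<And>k. u k \<le> \<phi>"
        "\<And>k. (0::real) \<le> t k" "\<And>k. u k \<le> t k *\<^sub>R w k" "\<And>k. L k \<phi> < G (u k) + \<eta>" by metis
      have "inf (u i) (u j) = 0" if "i \<noteq> j" for i j
      proof (rule order.antisym)
        have "inf (u i) (u j) \<le> inf (t i *\<^sub>R w i) (t j *\<^sub>R w j)" by (intro inf_mono u)
        also have "\<dots> = 0" by (intro disjoint_scaleR w u that)
        finally show "inf (u i) (u j) \<le> 0" .
      qed (simp add: u)
      hence le: "(\<Sum>k<n. u k) \<le> \<phi>" by (intro sum_disjoint_le \<phi> u)
      have "(\<Sum>k<n. L k \<phi>) \<le> (\<Sum>k<n. G (u k) + \<eta>)" by (intro sum_mono less_imp_le u)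
      also have "\<dots> = G (\<Sum>k<n. u k) + real n * \<eta>" by (simp add: sum.distrib blinfun.sum_right)
      also have "\<dots> \<le> G \<phi> + e"
        using e by (intro add_mono blinfun_mono[OF G le]) (simp add: \<eta>_def field_simps)
      finally show ?thesis .
    qed
    hence "(\<Sum>k<n. L k \<phi>) \<le> G \<phi>" by (rule field_le_epsilon)
    thus "blinfun_apply (\<Sum>k<n. L k) \<phi> \<le> G \<phi>" by (simp add: blinfun.sum_left)
  qed
  with L(1,2) show ?thesis by (intro exI[of _ L]) simp
qed

section \<open>Regular operators into spaces with the positive Schur property\<close>

lemma norm_bidual_apply_le:
  assumes "\<And>f. blinfun_apply F (dual_op T f) = blinfun_apply f y"
  shows "norm (dual_op (dual_op T) F) \<le> norm y"
proof (rule norm_blinfun_bound)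
  show "norm (blinfun_apply (dual_op (dual_op T) F) f) \<le> norm y * norm f" for f
    using norm_blinfun[of f y] by (simp add: dual_op_apply[of "dual_op T"] assms mult.commute)
qed simp

text \<open>For \<open>T = A - B\<close>, the functional \<open>\<phi>\<close> is \<open>f\<close> composed with \<open>A + B\<close>. It is positive, hence continuous.\<close>

lemma regular_dual_order_bounded:
  fixes T :: "'e::banach_lattice \<Rightarrow>\<^sub>L 'f::banach_lattice" and f :: "'f \<Rightarrow>\<^sub>L real"
  assumes T: "regular_op (blinfun_apply T)" and f: "0 \<le> f"
  shows "\<exists>\<phi>. \<forall>g. \<bar>g\<bar> \<le> f \<longrightarrow> \<bar>dual_op T g\<bar> \<le> \<phi>"
proof -
  obtain A B where AB: "positive_op A" "positive_op B" "\<And>x. T x = A x - B x"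
    using T unfolding regular_op_def by metis
  hence lin: "linear A" "linear B" and pos: "\<And>x. 0 \<le> x \<Longrightarrow> 0 \<le> A x" "\<And>x. 0 \<le> x \<Longrightarrow> 0 \<le> B x"
    by (auto simp: positive_op_def)
  define h where "h x = f (A x) + f (B x)" for x
  have "linear h"
    by (rule linearI) (simp_all add: h_def linear_add[OF lin(1)] linear_add[OF lin(2)]
      linear_scale[OF lin(1)] linear_scale[OF lin(2)] blinfun.bilinear_simps algebra_simps)
  have "0 \<le> h x" if "0 \<le> x" for x
    using that pos f by (simp add: h_def blinfun_nonneg)
  hence "\<exists>C. \<forall>k\<in>{h}. \<forall>x. \<bar>k x\<bar> \<le> norm x * C"
    using \<open>linear h\<close> by (intro positive_functionals_bounded) auto
  then obtain C where "\<And>x. \<bar>h x\<bar> \<le> norm x * C" by auto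
  from blinfun_of_linear[OF \<open>linear h\<close> this] obtain \<phi> :: "'e \<Rightarrow>\<^sub>L real" where \<phi>: "\<And>x. \<phi> x = h x"
    by blast
  show ?thesis
  proof (intro exI[of _ \<phi>] allI impI)
    fix g :: "'f \<Rightarrow>\<^sub>L real" assume g: "\<bar>g\<bar> \<le> f"
    have le: "\<bar>g z\<bar> \<le> f z" if "0 \<le> z" for z
    proof -
      have "\<bar>g z\<bar> \<le> blinfun_apply \<bar>g\<bar> z" using that by (intro abs_blinfun_apply_le) (simp add: abs_of_nonneg)
      also have "\<dots> \<le> f z" using g that by (simp add: less_eq_blinfun_def)
      finally show ?thesis .
    qed
    show "\<bar>dual_op T g\<bar> \<le> \<phi>"
    proof (rule abs_blinfun_leI)
      fix x :: 'e assume x: "0 \<le> x"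
      have "\<bar>blinfun_apply (dual_op T g) x\<bar> \<le> \<bar>g (A x)\<bar> + \<bar>g (B x)\<bar>"
        by (simp add: dual_op_apply AB(3) blinfun.diff_right)
      also have "\<dots> \<le> \<phi> x" unfolding \<phi> h_def using x pos by (intro add_mono le) auto
      finally show "\<bar>blinfun_apply (dual_op T g) x\<bar> \<le> \<phi> x" .
    qed
  qed
qed

text \<open>Let \<open>y n\<close> in the range space represent the image of \<open>F n\<close> under the second adjoint. The value of
\<open>f \<ge> 0\<close> at \<open>\<bar>y n\<bar>\<close> equals \<open>g (y n) = F n (dual_op T g)\<close> for some \<open>g\<close> with \<open>\<bar>g\<bar> \<le> f\<close>. Although \<open>g\<close> depends
on \<open>n\<close>, all these functionals \<open>dual_op T g\<close> lie in one order interval, on which \<open>F n\<close> tends to 0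
uniformly. So \<open>\<bar>y n\<bar>\<close> is positive and weakly null, hence norm null by the positive Schur property.\<close>

lemma bidual_null_regular:
  fixes T :: "'e::banach_lattice \<Rightarrow>\<^sub>L 'f::banach_lattice"
  assumes T: "weakly_compact_op T" "regular_op (blinfun_apply T)" "positive_Schur_property TYPE('f)"
    and F: "weak_star_null (\<lambda>n. \<bar>F n\<bar>)"
  shows "(\<lambda>n. dual_op (dual_op T) (F n)) \<longlonglongrightarrow> 0"
proof -
  have "\<forall>n. \<exists>y. \<forall>f. F n (dual_op T f) = blinfun_apply f y"
    using weakly_compact_bidual[OF T(1)] by blast
  then obtain y where y: "\<And>n f. F n (dual_op T f) = blinfun_apply f (y n)" by metis
  have "(\<lambda>n. f \<bar>y n\<bar>) \<longlonglongrightarrow> 0" if f: "0 \<le> f" for f :: "'f \<Rightarrow>\<^sub>L real"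
  proof -
    obtain \<phi> :: "'e \<Rightarrow>\<^sub>L real" where \<phi>: "\<And>g. \<bar>g\<bar> \<le> f \<Longrightarrow> \<bar>dual_op T g\<bar> \<le> \<phi>"
      using regular_dual_order_bounded[OF T(2) f] by blast
    have "\<bar>f \<bar>y n\<bar>\<bar> \<le> blinfun_apply \<bar>F n\<bar> \<phi>" for n
    proof -
      obtain g :: "'f \<Rightarrow>\<^sub>L real" where g: "\<bar>g\<bar> \<le> f" "f \<bar>y n\<bar> = g (y n)"
        using apply_abs_attained[OF f] by blast
      show ?thesis using abs_blinfun_apply_le[OF \<phi>[OF g(1)], of "F n"] by (simp add: g(2) y)
    qed
    hence "\<forall>\<^sub>F n in sequentially. norm (f \<bar>y n\<bar>) \<le> blinfun_apply \<bar>F n\<bar> \<phi>"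
      unfolding real_norm_def by (intro always_eventually allI)
    moreover have "(\<lambda>n. blinfun_apply \<bar>F n\<bar> \<phi>) \<longlonglongrightarrow> 0"
      using F unfolding weak_star_null_iff by blast
    ultimately show ?thesis by (rule Lim_null_comparison)
  qed
  hence "weakly_null (\<lambda>n. \<bar>y n\<bar>)" by (intro weakly_null_absI) simp
  hence "(\<lambda>n. \<bar>y n\<bar>) \<longlonglongrightarrow> 0" using T(3) by (simp add: positive_Schur_property_def)
  from tendsto_norm_zero[OF this] have lim: "(\<lambda>n. norm (y n)) \<longlonglongrightarrow> 0" by simp
  show ?thesis
    by (rule Lim_null_comparison[OF _ lim]) (simp add: norm_bidual_apply_le[OF y])
qed

section \<open>Positive operators on spaces whose dual has the positive Schur property\<close>

text \<open>A lower bound \<open>b\<close> of the sequence satisfies \<open>f (pprt b) \<le> 0\<close> for every \<open>f \<ge> 0\<close>, so \<open>pprt b = 0\<close> and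
the sequence decreases to 0 in order.\<close>

lemma order_continuous_weak_imp_norm:
  fixes D :: "nat \<Rightarrow> 'a::banach_lattice"
  assumes oc: "order_continuous_norm TYPE('a)"
    and D: "\<And>n. 0 \<le> D n" "antimono D"
    and weak: "\<And>f :: 'a \<Rightarrow>\<^sub>L real. 0 \<le> f \<Longrightarrow> (\<lambda>n. blinfun_apply f (D n)) \<longlonglongrightarrow> 0"
  shows "D \<longlonglongrightarrow> 0"
proof -
  have inf: "b \<le> 0" if b: "\<And>n. b \<le> D n" for b
  proof -
    have "0 \<le> - pprt b"
    proof (rule nonneg_if_functionals_nonneg)
      fix f :: "'a \<Rightarrow>\<^sub>L real" assume f: "0 \<le> f"
      have "f (pprt b) \<le> f (D n)" for n
        using D(1) b by (intro blinfun_mono[OF f]) (simp add: pprt_def)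
      with weak[OF f] have "f (pprt b) \<le> 0" by (intro LIMSEQ_le_const) auto
      thus "0 \<le> f (- pprt b)" by (simp add: blinfun.minus_right)
    qed
    hence "pprt b \<le> 0" by simp
    moreover have "b \<le> pprt b" by (simp add: pprt_def)
    ultimately show ?thesis by (rule order_trans[rotated])
  qed
  have dir: "\<exists>z\<in>range D. z \<le> x \<and> z \<le> y" if "x \<in> range D" "y \<in> range D" for x y
  proof -
    from that obtain m n where "x = D m" "y = D n" by blast
    thus ?thesis using antimonoD[OF D(2), of m "max m n"] antimonoD[OF D(2), of n "max m n"] by auto
  qed
  have "\<exists>n0. \<forall>n\<ge>n0. norm (D n) < e" if "0 < e" for e
  proof -
    have "\<forall>x\<in>range D. \<forall>y\<in>range D. \<exists>z\<in>range D. z \<le> x \<and> z \<le> y" using dir by blast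
    moreover have "\<forall>b. (\<forall>x\<in>range D. b \<le> x) \<longrightarrow> b \<le> 0" using inf by blast
    moreover have "range D \<noteq> {}" "\<forall>x\<in>range D. 0 \<le> x" using D(1) by auto
    ultimately have "\<exists>x\<in>range D. \<forall>y\<in>range D. y \<le> x \<longrightarrow> norm y < e"
      using spec[OF oc[unfolded order_continuous_norm_def], of "range D"] that by simp
    then obtain n0 where "\<And>n. D n \<le> D n0 \<Longrightarrow> norm (D n) < e" by blast
    thus ?thesis using antimonoD[OF D(2), of n0] by blast
  qed
  thus ?thesis by (simp add: LIMSEQ_def)
qed

text \<open>For \<open>G \<ge> 0\<close> on the dual let \<open>L k\<close> be disjoint components of \<open>G\<close> carried by the \<open>w k\<close>. The images of the
\<open>L k\<close> and of their sum \<open>s\<close> under the second adjoint lie in the range space, as \<open>z k\<close> and \<open>z'\<close>. The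
partial sums of the positive series of the \<open>z k\<close> increase weakly to \<open>z'\<close>, so by order continuity
they converge in norm and \<open>z k\<close> tends to 0. Since
\<open>G (w k) = L k (w k) \<le> L k (dual_op T (f k)) = f k (z k)\<close>, also \<open>G (w k)\<close> tends to 0.\<close>

lemma disjoint_below_dual_weakly_null:
  fixes T :: "'e::banach_lattice \<Rightarrow>\<^sub>L 'f::banach_lattice"
  assumes T: "weakly_compact_op T" "positive_op (blinfun_apply T)" "order_continuous_norm TYPE('f)"
    and f: "\<And>k. norm (f k) \<le> 1"
    and w: "\<And>k. 0 \<le> w k" "\<And>k. w k \<le> dual_op T (f k)" "\<And>m n. m \<noteq> n \<Longrightarrow> inf (w m) (w n) = 0"
  shows "weakly_null w"
proof (rule weakly_null_absI)
  fix G :: "('e \<Rightarrow>\<^sub>L real) \<Rightarrow>\<^sub>L real" assume G: "0 \<le> G"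
  obtain L :: "nat \<Rightarrow> ('e \<Rightarrow>\<^sub>L real) \<Rightarrow>\<^sub>L real" where
    L: "\<And>k. 0 \<le> L k" "\<And>k. L k (w k) = G (w k)" "\<And>n. (\<Sum>k<n. L k) \<le> G"
    using disjoint_components[of G w, OF G w(1,3)] by auto
  have "\<bar>L k\<bar> \<le> L k" for k using L(1) by (simp add: abs_of_nonneg)
  then obtain s :: "('e \<Rightarrow>\<^sub>L real) \<Rightarrow>\<^sub>L real" where s: "\<And>x. (\<lambda>k. L k x) sums s x"
    using dual_order_series[of L L G] L(3) by auto
  have "\<forall>k. \<exists>z. \<forall>g. L k (dual_op T g) = blinfun_apply g z"
    using weakly_compact_bidual[OF T(1)] by blast
  then obtain z where z: "\<And>k g. L k (dual_op T g) = blinfun_apply g (z k)" by metis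
  obtain z' where z': "\<And>g. s (dual_op T g) = blinfun_apply g z'"
    using weakly_compact_bidual[OF T(1)] by blast
  have dual_nonneg: "0 \<le> dual_op T g" if "0 \<le> g" for g
    using that T(2) by (auto simp: less_eq_blinfun_def dual_op_apply positive_op_def)
  have z0: "0 \<le> z k" for k
  proof (rule nonneg_if_functionals_nonneg)
    fix g :: "'f \<Rightarrow>\<^sub>L real" assume "0 \<le> g"
    from blinfun_nonneg[OF L(1) dual_nonneg[OF this]] show "0 \<le> g (z k)" by (simp only: z)
  qed
  define D where "D n = z' - (\<Sum>k<n. z k)" for n
  have sums: "(\<lambda>k. g (z k)) sums g z'" for g :: "'f \<Rightarrow>\<^sub>L real"
    using s[of "dual_op T g"] by (simp add: z z')
  have "D \<longlonglongrightarrow> 0"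
  proof (rule order_continuous_weak_imp_norm[OF T(3)])
    show "antimono D" by (rule decseq_SucI) (simp add: D_def z0)
    show "0 \<le> D n" for n
    proof (rule nonneg_if_functionals_nonneg)
      fix g :: "'f \<Rightarrow>\<^sub>L real" assume "0 \<le> g"
      hence "(\<Sum>k<n. g (z k)) \<le> g z'"
        unfolding sums_unique[OF sums[of g]] using z0 sums_summable[OF sums[of g]]
        by (intro sum_le_suminf) (auto simp: blinfun_nonneg)
      thus "0 \<le> g (D n)" by (simp add: D_def blinfun.diff_right blinfun.sum_right)
    qed
    show "(\<lambda>n. g (D n)) \<longlonglongrightarrow> 0" for g :: "'f \<Rightarrow>\<^sub>L real"
      using tendsto_diff[OF tendsto_const[of "g z'"] sums[of g, unfolded sums_def]]
      by (simp add: D_def blinfun.diff_right blinfun.sum_right)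
  qed
  from tendsto_diff[OF this LIMSEQ_Suc[OF this]] have "z \<longlonglongrightarrow> 0" by (simp add: D_def)
  hence lim: "(\<lambda>k. norm (z k)) \<longlonglongrightarrow> 0" by (rule tendsto_norm_zero)
  show "(\<lambda>k. G \<bar>w k\<bar>) \<longlonglongrightarrow> 0"
  proof (rule Lim_null_comparison[OF _ lim], rule always_eventually, rule allI)
    fix k
    have "norm (G \<bar>w k\<bar>) = L k (w k)" using w(1) G by (simp add: abs_of_nonneg L(2) blinfun_nonneg)
    also have "\<dots> \<le> L k (dual_op T (f k))" by (rule blinfun_mono[OF L(1) w(2)])
    also have "\<dots> = f k (z k)" by (rule z)
    also have "\<dots> \<le> norm (f k) * norm (z k)" using norm_blinfun[of "f k" "z k"] by simp
    also have "\<dots> \<le> norm (z k)" using f by (simp add: mult_left_le_one_le)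
    finally show "norm (G \<bar>w k\<bar>) \<le> norm (z k)" .
  qed
qed

text \<open>If the images of the \<open>F n\<close> do not tend to 0, some \<open>f k\<close> in the unit ball satisfy
\<open>\<bar>F (q k)\<bar> (dual_op T \<bar>f k\<bar>) \<ge> e / 2\<close>. This persists, with a smaller constant, for disjoint minorants
\<open>w k\<close> of the elements \<open>dual_op T \<bar>f k\<bar>\<close>. By the preceding lemma these are weakly null, hence norm null by
the positive Schur property; but the \<open>\<bar>F (q k)\<bar>\<close> are uniformly bounded.\<close>

lemma bidual_null_positive:
  fixes T :: "'e::banach_lattice \<Rightarrow>\<^sub>L 'f::banach_lattice"
  assumes T: "weakly_compact_op T" "positive_op (blinfun_apply T)" "order_continuous_norm TYPE('f)"
      "positive_Schur_property TYPE('e \<Rightarrow>\<^sub>L real)"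
    and F: "weak_star_null (\<lambda>n. \<bar>F n\<bar>)"
  shows "(\<lambda>n. dual_op (dual_op T) (F n)) \<longlonglongrightarrow> 0"
proof (rule ccontr)
  assume "\<not> ?thesis"
  then obtain e where e: "0 < e" "\<exists>\<^sub>\<infinity>n. e \<le> norm (dual_op (dual_op T) (F n))"
    by (auto simp: LIMSEQ_def INFM_nat_le not_less)
  define S where "S = {n. e \<le> norm (dual_op (dual_op T) (F n))}"
  have inf: "infinite S" using e(2) by (simp add: INFM_iff_infinite S_def)
  define q where "q = enumerate S"
  have q: "strict_mono q" "\<And>k. e \<le> norm (dual_op (dual_op T) (F (q k)))"
    using enumerate_in_set[OF inf] inf by (auto simp: q_def S_def strict_mono_enumerate)
  have "\<exists>f. norm f \<le> 1 \<and> e / 2 < \<bar>blinfun_apply (dual_op (dual_op T) (F (q k))) f\<bar>" for k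
    using e(1) q(2)[of k] by (intro less_norm_attained) auto
  then obtain f where f: "\<And>k. norm (f k) \<le> 1" "\<And>k. e / 2 < \<bar>F (q k) (dual_op T (f k))\<bar>"
    unfolding dual_op_apply[of "dual_op T"] by (simp, metis)
  define H where "H k = \<bar>F (q k)\<bar>" for k
  define \<phi> where "\<phi> k = dual_op T \<bar>f k\<bar>" for k
  have H: "0 \<le> H k" for k by (simp add: H_def)
  have H0: "weak_star_null H"
    using F LIMSEQ_subseq_LIMSEQ[OF _ q(1)] unfolding weak_star_null_iff H_def o_def by blast
  have \<phi>0: "0 \<le> \<phi> k" for k
  proof -
    have "0 \<le> \<bar>f k\<bar> (T x)" if "0 \<le> x" for x
      using T(2) that by (intro blinfun_nonneg) (auto simp: positive_op_def)
    thus ?thesis by (simp add: \<phi>_def less_eq_blinfun_def dual_op_apply)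
  qed
  have \<phi>_norm: "norm (\<phi> k) \<le> norm (dual_op T)" for k
  proof -
    have "norm (\<phi> k) \<le> norm (dual_op T) * norm \<bar>f k\<bar>" unfolding \<phi>_def by (rule norm_blinfun)
    also have "\<dots> \<le> norm (dual_op T)" using f(1)[of k] by (simp add: mult_left_le)
    finally show ?thesis .
  qed
  have H\<phi>: "e / 2 \<le> H k (\<phi> k)" for k
  proof -
    have "\<bar>dual_op T (f k)\<bar> \<le> \<phi> k"
    proof (rule abs_blinfun_leI)
      fix x :: 'e assume "0 \<le> x"
      hence "\<bar>T x\<bar> \<le> T x" using T(2) by (simp add: positive_op_def abs_of_nonneg)
      thus "\<bar>blinfun_apply (dual_op T (f k)) x\<bar> \<le> \<phi> k x"
        unfolding \<phi>_def dual_op_apply by (simp add: abs_blinfun_apply_le)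
    qed
    from abs_blinfun_apply_le[OF this, of "F (q k)"] f(2)[of k] show ?thesis by (simp add: H_def)
  qed
  obtain r w where r: "strict_mono (r :: nat \<Rightarrow> nat)" and w: "\<And>k. 0 \<le> w k" "\<And>k. w k \<le> \<phi> (r k)"
    "\<And>m n. m \<noteq> n \<Longrightarrow> inf (w m) (w n) = 0" "\<forall>\<^sub>F k in sequentially. e / 2 / 2 \<le> H (r k) (w k)"
    by (rule disjoint_minorants[of H \<phi> "norm (dual_op T)" "e / 2", OF H H0 \<phi>0 \<phi>_norm _ H\<phi>])
       (use e(1) in simp, blast)
  have "weakly_null w"
    using f(1) w by (intro disjoint_below_dual_weakly_null[OF T(1-3), of "\<lambda>k. \<bar>f (r k)\<bar>"]) (auto simp: \<phi>_def)
  hence w_lim: "w \<longlonglongrightarrow> 0" using T(4) w(1) by (simp add: positive_Schur_property_def)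
  have "\<exists>c. \<forall>h\<in>range (\<lambda>k. blinfun_apply (H k)). h x \<le> c" for x
  proof -
    have "convergent (\<lambda>k. H k x)" using H0 by (auto simp: weak_star_null_iff convergent_def)
    hence "Bseq (\<lambda>k. H k x)" by (rule convergent_imp_Bseq)
    then obtain c where "\<forall>k. norm (H k x) \<le> c" by (rule BseqE)
    thus ?thesis by (intro exI[of _ c]) (auto simp: abs_le_iff)
  qed
  hence "\<exists>C. \<forall>h\<in>range (\<lambda>k. blinfun_apply (H k)). \<forall>x. \<bar>h x\<bar> \<le> norm x * C"
    using H by (intro positive_functionals_bounded)
      (auto simp: blinfun_nonneg blinfun.bounded_linear_right bounded_linear.linear)
  then obtain C where C: "\<And>k x. \<bar>H k x\<bar> \<le> norm x * C" by auto
  have "(\<lambda>k. H (r k) (w k)) \<longlonglongrightarrow> 0"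
  proof (rule Lim_null_comparison)
    show "\<forall>\<^sub>F k in sequentially. norm (H (r k) (w k)) \<le> norm (w k) * C" using C by simp
    show "(\<lambda>k. norm (w k) * C) \<longlonglongrightarrow> 0"
      using tendsto_mult_right[OF tendsto_norm_zero[OF w_lim], of C] by simp
  qed
  from tendsto_lowerbound[OF this w(4)] have "e / 2 / 2 \<le> 0" by simp
  thus False using e(1) by simp
qed

theorem proposition4p8:
  fixes T :: "'e::banach_lattice \<Rightarrow>\<^sub>L 'f::banach_lattice"
  assumes "weakly_compact_op T"
    and "(regular_op (blinfun_apply T) \<and> positive_Schur_property TYPE('f)) \<or>
      (positive_op (blinfun_apply T) \<and> order_continuous_norm TYPE('f) \<and>
        positive_Schur_property TYPE('e \<Rightarrow>\<^sub>L real))"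
  shows "almost_limited (dual_op T) \<and> almost_Dunford_Pettis (dual_op (dual_op T))"
proof -
  have main: "(\<lambda>n. dual_op (dual_op T) (F n)) \<longlonglongrightarrow> 0" if "disjoint_seq F" "weak_star_null F" for F
    using assms bidual_null_regular[OF _ _ _ abs_weak_star_null[OF that]]
      bidual_null_positive[OF _ _ _ _ abs_weak_star_null[OF that]] by blast
  have "weak_star_null F" if "weakly_null F" for F :: "nat \<Rightarrow> ('e \<Rightarrow>\<^sub>L real) \<Rightarrow>\<^sub>L real"
    unfolding weak_star_null_iff
  proof
    fix \<phi> :: "'e \<Rightarrow>\<^sub>L real"
    have "bounded_linear (\<lambda>G. blinfun_apply G \<phi>)" by (rule blinfun.bounded_linear_left)
    moreover have "(\<lambda>n. blinfun_apply (Blinfun (\<lambda>G. blinfun_apply G \<phi>)) (F n)) \<longlonglongrightarrow> 0"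
      using that unfolding weakly_null_iff by blast
    ultimately show "(\<lambda>n. F n \<phi>) \<longlonglongrightarrow> 0" by (simp add: bounded_linear_Blinfun_apply)
  qed
  with main show ?thesis unfolding almost_limited_def almost_Dunford_Pettis_def by blast
qed

end
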